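(* Let $X,Y$ be Banach spaces such that $X^*$ or $Y$ has the approximation property, and fix $1<p<\infty$. If $X^*$ and $Y$ are both asymptotically uniformly smooth (resp. both $p$-asymptotically uniformly smooth, resp. both asymptotically uniformly flat), then the space $\mathcal K(X,Y)$ of compact operators from $X$ to $Y$, with the operator norm, is asymptotically uniformly smooth (resp. $p$-asymptotically uniformly smooth, resp. asymptotically uniformly flat). In particular, if $1/p+1/q=1$, $X$ is reflexive and $q$-asymptotically uniformly convex, and $Y$ is $p$-asymptotically uniformly smooth, then $\mathcal K(X,Y)$ is $p$-asymptotically uniformly smooth.
   Context: For a Banach space $Z$ and $\sigma>0$, $\rho_Z(\sigma)=\sup\{\limsup_\lambda\|z+z_\lambda\|-1: z\in B_Z,\ (z_\lambda)\text{ a weakly null net in }\sigma B_Z\}$. $Z$ is asymptotically uniformly smooth if $\lim_{\sigma\to0^+}\rho_Z(\sigma)/\sigma=0$, $p$-asymptotically uniformly smooth if $\sup_{\sigma>0}\rho_Z(\sigma)/\sigma^p<\infty$, asymptotically uniformly flat if $\rho_Z(\sigma)=0$ for some $\sigma>0$. $X$ is $q$-asymptotically uniformly convex if there is $c>0$ with $\bar\delta_X(\tau)\ge c\tau^q$ for all $0<\tau\le1$, where $\bar\delta_X(\tau)=\inf_{x\in S_X}\sup_{E}\inf_{y\in S_E}\|x+\tau y\|-1$, $E$ ranging over closed finite-codimensional subspaces of $X$. *)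

theory Defs
  imports "HOL-Analysis.Analysis"
begin

text \<open>All Banach spaces are real. A Banach space Z is either a type of class banach
 (taking Z = UNIV) or a closed linear subspace S of such a type (for K(X,Y)).\<close>

text \<open>Weak convergence to 0 within the (normed) subspace S: every bounded linear
 functional on S tends to 0. Nets are represented, as usual in Isabelle, by filters.\<close>
definition weakly_null_in :: "'a::real_normed_vector set \<Rightarrow> 'a filter \<Rightarrow> bool" where
  "weakly_null_in S F \<longleftrightarrow>
     (\<forall>f::'a \<Rightarrow> real.
        ((\<forall>x\<in>S. \<forall>y\<in>S. f (x + y) = f x + f y) \<and>
         (\<forall>c. \<forall>x\<in>S. f (c *\<^sub>R x) = c * f x) \<and>
         (\<exists>C. \<forall>x\<in>S. \<bar>f x\<bar> \<le> C * norm x))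
        \<longrightarrow> (f \<longlongrightarrow> 0) F)"

definition aus_modulus :: "'a::real_normed_vector set \<Rightarrow> real \<Rightarrow> real" where
  "aus_modulus S \<sigma> =
     real_of_ereal (SUP zF \<in> {(z, F). z \<in> S \<and> norm z \<le> 1 \<and> F \<noteq> bot \<and>
                              (\<forall>\<^sub>F w in F. w \<in> S \<and> norm w \<le> \<sigma>) \<and> weakly_null_in S F}.
                     Limsup (snd zF) (\<lambda>w. ereal (norm (fst zF + w)))) - 1"

definition AUS :: "'a::real_normed_vector set \<Rightarrow> bool" where
  "AUS S \<longleftrightarrow> ((\<lambda>\<sigma>. aus_modulus S \<sigma> / \<sigma>) \<longlongrightarrow> 0) (at_right 0)"

definition p_AUS :: "real \<Rightarrow> 'a::real_normed_vector set \<Rightarrow> bool" where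
  "p_AUS p S \<longleftrightarrow> (\<exists>C. \<forall>\<sigma>>0. aus_modulus S \<sigma> / \<sigma> powr p \<le> C)"

definition AUF :: "'a::real_normed_vector set \<Rightarrow> bool" where
  "AUF S \<longleftrightarrow> (\<exists>\<sigma>>0. aus_modulus S \<sigma> = 0)"

definition fin_codim_subspace :: "'a::real_normed_vector set \<Rightarrow> bool" where
  "fin_codim_subspace E \<longleftrightarrow> closed E \<and> subspace E \<and>
     (\<exists>B. finite B \<and> span (E \<union> B) = UNIV)"

definition auc_modulus :: "'a::real_normed_vector itself \<Rightarrow> real \<Rightarrow> ereal" where
  "auc_modulus _ \<tau> =
     (INF x \<in> sphere (0::'a) 1. SUP E \<in> {E. fin_codim_subspace E}.
        INF y \<in> E \<inter> sphere 0 1. ereal (norm (x + \<tau> *\<^sub>R y))) - 1"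

definition q_AUC :: "real \<Rightarrow> 'a::real_normed_vector itself \<Rightarrow> bool" where
  "q_AUC q X \<longleftrightarrow> (\<exists>c>0. \<forall>\<tau>. 0 < \<tau> \<and> \<tau> \<le> 1 \<longrightarrow> auc_modulus X \<tau> \<ge> ereal (c * \<tau> powr q))"

definition reflexive_space :: "'a::real_normed_vector itself \<Rightarrow> bool" where
  "reflexive_space _ \<longleftrightarrow>
     (\<forall>\<phi> :: ('a \<Rightarrow>\<^sub>L real) \<Rightarrow>\<^sub>L real. \<exists>x::'a. \<forall>f. blinfun_apply \<phi> f = blinfun_apply f x)"

definition has_AP :: "'a::real_normed_vector itself \<Rightarrow> bool" where
  "has_AP _ \<longleftrightarrow>
     (\<forall>K::'a set. \<forall>\<epsilon>>0. compact K \<longrightarrow>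
        (\<exists>T::'a \<Rightarrow>\<^sub>L 'a. (\<exists>B. finite B \<and> range (blinfun_apply T) \<subseteq> span B) \<and>
                          (\<forall>x\<in>K. norm (blinfun_apply T x - x) < \<epsilon>)))"

definition compact_ops :: "('a::real_normed_vector \<Rightarrow>\<^sub>L 'b::real_normed_vector) set" where
  "compact_ops = {T. compact (closure (blinfun_apply T ` cball 0 1))}"

end

theory Submission
  imports Defs
begin

text \<open>
  Let \<open>W\<close> run through a weakly null net of compact operators with \<open>\<parallel>W\<parallel> \<le> \<sigma>\<close>, and let \<open>x W\<close>, \<open>y W\<close> in
  the balls of \<open>X\<close> and \<open>Y*\<close> almost norm \<open>T + W\<close>. Along an ultrafilter, \<open>y W \<rightarrow> G\<close> weak-star in \<open>Y*\<close> and
  \<open>x W \<rightarrow> H\<close> weak-star in \<open>X**\<close>, with \<open>\<parallel>y W - G\<parallel> \<rightarrow> u\<close> and \<open>\<parallel>x W - H\<parallel> \<rightarrow> v\<close>. Compactness of \<open>T\<close> and weak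
  nullity of \<open>W\<close> against \<open>H \<otimes> G\<close> give \<open>lim \<parallel>T + W\<parallel> \<le> \<parallel>G\<parallel> \<parallel>H\<parallel> + \<sigma> (u + v)\<close>. Asymptotic smoothness of
  \<open>Y\<close> and \<open>X*\<close> dualises to \<open>\<parallel>G\<parallel> + 2 \<sigma> u \<le> 1 + \<rho>\<^sub>Y(4 \<sigma>)\<close> and \<open>\<parallel>H\<parallel> + 2 \<sigma> v \<le> 1 + \<rho>\<^sub>X\<^sub>*(4 \<sigma>)\<close>, whence
  \<open>\<rho>\<^sub>K(\<sigma>) \<le> max (\<rho>\<^sub>X\<^sub>*(4 \<sigma>)) (\<rho>\<^sub>Y(4 \<sigma>))\<close>, which settles all three cases at once. In the reflexive case the
  same norming argument in \<open>X*\<close>, played against asymptotic uniform convexity of \<open>X\<close> at the scale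
  \<open>\<tau> = (\<sigma>/c)\<^sup>p\<^sup>-\<^sup>1\<close>, shows that \<open>X*\<close> is \<open>p\<close>-asymptotically uniformly smooth.
\<close>

section \<open>Limits along ultrafilters\<close>

definition ultra :: "'i filter \<Rightarrow> bool" where
  "ultra U \<longleftrightarrow> U \<noteq> bot \<and> (\<forall>P. eventually P U \<or> eventually (\<lambda>i. \<not> P i) U)"

text \<open>Zorn's lemma on the proper filters below \<open>F\<close>, with the order reversed so
  that maximal elements are minimal filters. A minimal filter decides every predicate: one that it
  does not refute can be added without losing properness.\<close>

lemma ex_ultra_le:
  assumes "F \<noteq> bot"
  shows "\<exists>U. ultra U \<and> U \<le> F"
proof -
  let ?A = "{G. G \<noteq> bot \<and> G \<le> F}"
  have "\<exists>U\<in>?A. \<forall>G\<in>?A. G \<le> U \<longrightarrow> G = U"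
  proof (rule predicate_Zorn)
    show "partial_order_on ?A (relation_of (\<lambda>G H. H \<le> G) ?A)"
      by (rule partial_order_on_relation_ofI) auto
    fix C assume C: "C \<in> Chains (relation_of (\<lambda>G H. H \<le> G) ?A)"
    show "\<exists>U\<in>?A. \<forall>G\<in>C. U \<le> G"
    proof (cases "C = {}")
      case True
      then show ?thesis using assms by auto
    next
      case False
      have CA: "C \<subseteq> ?A" and total: "\<And>G H. G \<in> C \<Longrightarrow> H \<in> C \<Longrightarrow> G \<le> H \<or> H \<le> G"
        using C by (auto simp: Chains_def relation_of_def)
      \<comment> \<open>A nonempty chain is a filter base, so an event of \<open>Inf C\<close> is
        already an event of a single member; this makes \<open>Inf C\<close> proper.\<close>
      have base: "\<exists>K\<in>C. K \<le> inf G H" if "G \<in> C" "H \<in> C" for G H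
        using total[OF that] that by (auto intro: le_infI)
      have "\<not> eventually (\<lambda>_. False) (Inf C)"
      proof
        assume ev: "eventually (\<lambda>_. False) (Inf C)"
        obtain G where "G \<in> C" "eventually (\<lambda>_. False) G"
          using iffD1[OF eventually_Inf_base[OF False base] ev] by blast
        then show False
          using CA by (auto simp: eventually_False)
      qed
      then have "Inf C \<noteq> bot"
        by (simp add: eventually_False)
      moreover have "Inf C \<le> F"
      proof -
        obtain G where "G \<in> C" using False by blast
        then show ?thesis
          using CA order_trans[OF Inf_lower[of G C]] by auto
      qed
      ultimately show ?thesis
        by (auto intro: Inf_lower)
    qed
  qed
  then obtain U where U: "U \<noteq> bot" "U \<le> F"
    and min: "\<And>G. G \<noteq> bot \<Longrightarrow> G \<le> F \<Longrightarrow> G \<le> U \<Longrightarrow> G = U"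
    by blast
  have "eventually P U \<or> eventually (\<lambda>i. \<not> P i) U" for P
  proof (rule disjCI)
    assume "\<not> eventually (\<lambda>i. \<not> P i) U"
    then have "inf U (principal {i. P i}) \<noteq> bot"
      by (auto simp: eventually_inf_principal simp flip: eventually_False)
    then have "inf U (principal {i. P i}) = U"
      using U by (intro min) (auto intro: le_infI1)
    then have "U \<le> principal {i. P i}"
      by (metis inf.cobounded2)
    then show "eventually P U"
      by (simp add: le_principal)
  qed
  with U show ?thesis
    by (auto simp: ultra_def)
qed

text \<open>Compactness gives a cluster point, and an ultrafilter converges to each of its cluster
  points because it decides every open neighbourhood. This replaces passing to subnets.\<close>

lemma ultra_convergent:
  fixes h :: "'i \<Rightarrow> 'x::topological_space"
  assumes U: "ultra U" and K: "compact K" and ev: "eventually (\<lambda>i. h i \<in> K) U"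
  obtains l where "l \<in> K" "(h \<longlongrightarrow> l) U"
proof -
  have "filtermap h U \<noteq> bot" "eventually (\<lambda>x. x \<in> K) (filtermap h U)"
    using U ev by (auto simp: ultra_def filtermap_bot_iff eventually_filtermap)
  then obtain l where l: "l \<in> K" "inf (nhds l) (filtermap h U) \<noteq> bot"
    using K unfolding compact_filter by blast
  have "(h \<longlongrightarrow> l) U"
  proof (rule topological_tendstoI)
    fix S assume S: "open S" "l \<in> S"
    have "\<not> eventually (\<lambda>i. h i \<notin> S) U"
    proof
      assume "eventually (\<lambda>i. h i \<notin> S) U"
      then have "eventually (\<lambda>x. x \<notin> S) (filtermap h U)"
        by (simp add: eventually_filtermap)
      moreover have "eventually (\<lambda>x. x \<in> S) (nhds l)"
        using S by (simp add: eventually_nhds) blast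
      ultimately have "eventually (\<lambda>_. False) (inf (nhds l) (filtermap h U))"
        unfolding eventually_inf by blast
      then show False
        using l(2) by (simp add: eventually_False)
    qed
    then show "eventually (\<lambda>i. h i \<in> S) U"
      using U unfolding ultra_def by blast
  qed
  then show ?thesis
    using l that by blast
qed

lemma ultra_convergent_real:
  fixes h :: "'i \<Rightarrow> real"
  assumes "ultra U" "eventually (\<lambda>i. \<bar>h i\<bar> \<le> M) U"
  obtains l where "(h \<longlongrightarrow> l) U"
  by (rule ultra_convergent[OF assms(1) compact_Icc[of "-M" M], of h])
     (use assms(2) in \<open>auto simp: abs_le_iff minus_le_iff elim!: eventually_mono\<close>)

text \<open>Banach-Alaoglu along an ultrafilter: the bounded scalar nets converge pointwise, and
  linearity and the bound \<open>M\<close> survive in the limit.\<close>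

lemma weak_star_limit:
  fixes g :: "'i \<Rightarrow> 'z::real_normed_vector \<Rightarrow>\<^sub>L real"
  assumes U: "ultra U" and g: "\<And>i. norm (g i) \<le> M"
  obtains G :: "'z \<Rightarrow>\<^sub>L real"
  where "\<And>z. ((\<lambda>i. g i z) \<longlongrightarrow> G z) U" "norm G \<le> M"
proof -
  have nb: "U \<noteq> bot"
    using U by (simp add: ultra_def)
  have bd: "\<bar>g i z\<bar> \<le> M * norm z" for i z
    using norm_blinfun[of "g i" z] mult_right_mono[OF g[of i] norm_ge_zero[of z]] by simp
  have "\<exists>l. ((\<lambda>i. g i z) \<longlongrightarrow> l) U" for z
    by (rule ultra_convergent_real[OF U, of "\<lambda>i. g i z" "M * norm z"]) (use bd in auto)
  then obtain L where L: "\<And>z. ((\<lambda>i. g i z) \<longlongrightarrow> L z) U"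
    by metis
  have Lb: "\<bar>L z\<bar> \<le> M * norm z" for z
    by (rule tendsto_upperbound[OF tendsto_rabs[OF L[of z]] _ nb]) (use bd in auto)
  have "bounded_linear L"
  proof
    show "L (x + y) = L x + L y" for x y
      using tendsto_unique[OF nb L[of "x + y"]] tendsto_add[OF L[of x] L[of y]]
      by (simp add: blinfun.add_right)
    show "L (c *\<^sub>R x) = c *\<^sub>R L x" for c x
      using tendsto_unique[OF nb L[of "c *\<^sub>R x"]] tendsto_mult_left[OF L[of x], of c]
      by (simp add: blinfun.scaleR_right)
    show "\<exists>K. \<forall>x. norm (L x) \<le> norm x * K"
      using Lb by (auto simp: mult.commute)
  qed
  then have app: "blinfun_apply (Blinfun L) = L"
    by (rule bounded_linear_Blinfun_apply)
  \<comment> \<open>The index type is inhabited, so \<open>M\<close> bounds the norm of at least one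
    functional.\<close>
  moreover have "0 \<le> M"
    using g[of undefined] norm_ge_zero order_trans by blast
  ultimately have "norm (Blinfun L) \<le> M"
    using Lb by (intro norm_blinfun_bound) auto
  then show ?thesis
    using that[of "Blinfun L"] L app by auto
qed

section \<open>The Hahn--Banach theorem\<close>

text \<open>Homogeneity is asked only as an inequality for \<open>c > 0\<close>, which is easy to
  verify for infima; applying it to \<open>inverse c\<close> recovers equality.\<close>

definition sublinear :: "('a::real_vector \<Rightarrow> real) \<Rightarrow> bool" where
  "sublinear p \<longleftrightarrow> (\<forall>x y. p (x + y) \<le> p x + p y) \<and> (\<forall>c>0. \<forall>x. p (c *\<^sub>R x) \<le> c * p x)"

lemma sublinear_add: "sublinear p \<Longrightarrow> p (x + y) \<le> p x + p y"
  by (simp add: sublinear_def)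

lemma sublinear_0: "sublinear p \<Longrightarrow> p 0 = 0"
proof -
  assume p: "sublinear p"
  then have "p ((1/2) *\<^sub>R 0) \<le> 1/2 * p 0"
    unfolding sublinear_def by (metis half_gt_zero zero_less_one)
  then show "p 0 = 0"
    using sublinear_add[OF p, of 0 0] by simp
qed

lemma sublinear_scaleR:
  assumes p: "sublinear p" and "0 \<le> c"
  shows "p (c *\<^sub>R x) = c * p x"
proof (cases "c = 0")
  case True
  then show ?thesis using sublinear_0[OF p] by simp
next
  case False
  with assms(2) have c: "c > 0" by simp
  have "p (inverse c *\<^sub>R (c *\<^sub>R x)) \<le> inverse c * p (c *\<^sub>R x)"
    using p c unfolding sublinear_def by (metis inverse_positive_iff_positive)
  then have "c * p x \<le> p (c *\<^sub>R x)"
    using c by (simp add: field_simps)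
  then show ?thesis
    using p c unfolding sublinear_def by (simp add: antisym)
qed

lemma sublinear_neg: "sublinear p \<Longrightarrow> - p (- x) \<le> p x"
  using sublinear_add[of p x "- x"] sublinear_0[of p] by simp

text \<open>The infimum of \<open>p (x + t y) - t p y\<close> over \<open>t \<ge> 0\<close> is
  finite, being at least \<open>- p (- x)\<close>. Taking \<open>t = 0\<close> puts it below
  \<open>p\<close>, and \<open>t = 1\<close> gives the bound at \<open>- y\<close>. It serves both
  to fix a value at \<open>y\<close> and to show that a minimal sublinear functional is odd.\<close>

lemma sublinear_below:
  assumes p: "sublinear p"
  obtains q where "sublinear q" "\<And>x. q x \<le> p x" "q (- y) \<le> - p y"
proof -
  define q where "q x = (INF t\<in>{0..}. p (x + t *\<^sub>R y) - t * p y)" for x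
  have low: "- p (- x) \<le> p (x + t *\<^sub>R y) - t * p y" if "t \<ge> 0" for t x
    using sublinear_add[OF p, of "x + t *\<^sub>R y" "- x"] sublinear_scaleR[OF p that, of y] by simp
  have bdd: "bdd_below ((\<lambda>t. p (x + t *\<^sub>R y) - t * p y) ` {0..})" for x
    using low by (intro bdd_belowI2) auto
  have q_le: "q x \<le> p (x + t *\<^sub>R y) - t * p y" if "t \<ge> 0" for t x
    unfolding q_def using that by (intro cINF_lower[OF bdd]) auto
  have q_ex: "\<exists>t\<ge>0. p (x + t *\<^sub>R y) - t * p y < q x + e" if "e > 0" for e x
  proof -
    have "(INF t\<in>{0..}. p (x + t *\<^sub>R y) - t * p y) < q x + e"
      using that by (simp add: q_def)
    then show ?thesis
      by (subst (asm) cINF_less_iff[OF _ bdd]) auto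
  qed
  have "q (x1 + x2) \<le> q x1 + q x2" for x1 x2
  proof (rule field_le_epsilon)
    fix e :: real assume "e > 0"
    then obtain t1 t2 where t: "t1 \<ge> 0" "t2 \<ge> 0"
      "p (x1 + t1 *\<^sub>R y) - t1 * p y < q x1 + e/2" "p (x2 + t2 *\<^sub>R y) - t2 * p y < q x2 + e/2"
      using q_ex[of "e/2"] by (meson half_gt_zero)
    have "q (x1 + x2) \<le> p ((x1 + t1 *\<^sub>R y) + (x2 + t2 *\<^sub>R y)) - (t1 + t2) * p y"
      using q_le[of "t1 + t2" "x1 + x2"] t by (simp add: algebra_simps)
    also have "\<dots> \<le> p (x1 + t1 *\<^sub>R y) + p (x2 + t2 *\<^sub>R y) - (t1 + t2) * p y"
      using sublinear_add[OF p] by simp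
    finally show "q (x1 + x2) \<le> q x1 + q x2 + e"
      using t by (simp add: algebra_simps)
  qed
  moreover have "q (c *\<^sub>R x) \<le> c * q x" if c: "c > 0" for c x
  proof (rule field_le_epsilon)
    fix e :: real assume "e > 0"
    then obtain t where t: "t \<ge> 0" "p (x + t *\<^sub>R y) - t * p y < q x + e/c"
      using q_ex[of "e/c"] c by auto
    have "q (c *\<^sub>R x) \<le> p (c *\<^sub>R (x + t *\<^sub>R y)) - (c * t) * p y"
      using q_le[of "c * t" "c *\<^sub>R x"] t c by (simp add: algebra_simps)
    also have "\<dots> = c * (p (x + t *\<^sub>R y) - t * p y)"
      using sublinear_scaleR[OF p, of c "x + t *\<^sub>R y"] c by (simp add: right_diff_distrib mult.assoc)
    also have "\<dots> \<le> c * (q x + e/c)"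
      using t c by simp
    finally show "q (c *\<^sub>R x) \<le> c * q x + e"
      using c by (simp add: algebra_simps)
  qed
  ultimately have "sublinear q"
    by (simp add: sublinear_def)
  moreover have "q x \<le> p x" for x
    using q_le[of 0 x] by simp
  moreover have "q (- y) \<le> - p y"
    using q_le[of 1 "- y"] sublinear_0[OF p] by simp
  ultimately show ?thesis
    using that by blast
qed

text \<open>A minimal sublinear functional is linear, and Zorn's lemma yields a minimal one below \<open>p\<close>;
  starting from the functional of \<open>sublinear_below\<close> forces the value at \<open>y\<close>.\<close>

theorem Hahn_Banach_sublinear:
  assumes p: "sublinear p"
  obtains f where "linear f" "\<And>x. f x \<le> p x" "f y = p y"
proof -
  obtain p0 where p0: "sublinear p0" "\<And>x. p0 x \<le> p x" "p0 (- y) \<le> - p y"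
    using sublinear_below[OF p] by blast
  let ?A = "{q. sublinear q \<and> q \<le> p0}"
  have "\<exists>m\<in>?A. \<forall>q\<in>?A. q \<le> m \<longrightarrow> q = m"
  proof (rule predicate_Zorn)
    show "partial_order_on ?A (relation_of (\<lambda>q r. r \<le> q) ?A)"
      by (rule partial_order_on_relation_ofI) auto
    fix C assume C: "C \<in> Chains (relation_of (\<lambda>q r. r \<le> q) ?A)"
    show "\<exists>r\<in>?A. \<forall>q\<in>C. r \<le> q"
    proof (cases "C = {}")
      case True
      then show ?thesis using p0 by auto
    next
      case False
      have CA: "C \<subseteq> ?A" and total: "\<And>q r. q \<in> C \<Longrightarrow> r \<in> C \<Longrightarrow> q \<le> r \<or> r \<le> q"
        using C by (auto simp: Chains_def relation_of_def)
      define r where "r x = (INF q\<in>C. q x)" for x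
      have bdd: "bdd_below ((\<lambda>q. q x) ` C)" for x
      proof (rule bdd_belowI2)
        fix q assume "q \<in> C"
        then have "sublinear q" "q (- x) \<le> p0 (- x)"
          using CA by (auto simp: le_fun_def)
        then show "- p0 (- x) \<le> q x"
          using sublinear_neg[of q x] by simp
      qed
      have r_le: "r x \<le> q x" if "q \<in> C" for q x
        unfolding r_def using that by (intro cINF_lower[OF bdd])
      have r_ex: "\<exists>q\<in>C. q x < r x + e" if "e > 0" for e x
      proof -
        have "(INF q\<in>C. q x) < r x + e"
          using that by (simp add: r_def)
        then show ?thesis
          by (subst (asm) cINF_less_iff[OF False bdd])
      qed
      have "r (x1 + x2) \<le> r x1 + r x2" for x1 x2
      proof (rule field_le_epsilon)
        fix e :: real assume "e > 0"
        then obtain q1 q2 where q: "q1 \<in> C" "q2 \<in> C" "q1 x1 < r x1 + e/2" "q2 x2 < r x2 + e/2"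
          using r_ex[of "e/2"] by (meson half_gt_zero)
        \<comment> \<open>Near-minimisers at \<open>x1\<close> and \<open>x2\<close> may differ; the
          smaller one, by totality of the chain, works at both points.\<close>
        then obtain q where "q \<in> C" "q \<le> q1" "q \<le> q2"
          using total by blast
        then have "q (x1 + x2) \<le> q x1 + q x2" "q x1 \<le> q1 x1" "q x2 \<le> q2 x2"
          using CA sublinear_add[of q x1 x2] by (auto simp: le_fun_def)
        then show "r (x1 + x2) \<le> r x1 + r x2 + e"
          using r_le[OF \<open>q \<in> C\<close>, of "x1 + x2"] q by linarith
      qed
      moreover have "r (c *\<^sub>R x) \<le> c * r x" if c: "c > 0" for c x
      proof (rule field_le_epsilon)
        fix e :: real assume "e > 0"
        then obtain q where q: "q \<in> C" "q x < r x + e/c"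
          using r_ex[of "e/c"] c by auto
        have "r (c *\<^sub>R x) \<le> q (c *\<^sub>R x)"
          using r_le q by blast
        also have "\<dots> \<le> c * q x"
          using q CA c by (auto simp: sublinear_def)
        also have "\<dots> \<le> c * (r x + e/c)"
          using q c by simp
        finally show "r (c *\<^sub>R x) \<le> c * r x + e"
          using c by (simp add: algebra_simps)
      qed
      ultimately have "sublinear r"
        by (simp add: sublinear_def)
      moreover obtain q where "q \<in> C" using False by blast
      then have "r \<le> p0"
        using r_le[of q] CA by (force simp: le_fun_def intro: order_trans)
      ultimately show ?thesis
        using r_le by (intro bexI[of _ r]) (auto simp: le_fun_def)
    qed
  qed
  then obtain m where m: "sublinear m" "m \<le> p0"
    and min: "\<And>q. sublinear q \<Longrightarrow> q \<le> p0 \<Longrightarrow> q \<le> m \<Longrightarrow> q = m"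
    by blast
  \<comment> \<open>Lowering \<open>m\<close> at \<open>- x\<close> cannot produce a smaller
    functional, so \<open>m (- x) \<le> - m x\<close> held already.\<close>
  have neg: "m (- x) = - m x" for x
  proof -
    obtain q where q: "sublinear q" "\<And>z. q z \<le> m z" "q (- x) \<le> - m x"
      using sublinear_below[OF m(1)] by blast
    then have "q = m"
      using m(2) by (intro min) (auto simp: le_fun_def intro: order_trans)
    then show ?thesis
      using q(3) sublinear_neg[OF m(1), of x] by simp
  qed
  have "linear m"
  proof (rule linearI)
    show "m (x + z) = m x + m z" for x z
      using sublinear_add[OF m(1), of x z] sublinear_add[OF m(1), of "x + z" "- z"] neg[of z] by simp
    show "m (c *\<^sub>R x) = c *\<^sub>R m x" for c x
      using sublinear_scaleR[OF m(1), of c x] sublinear_scaleR[OF m(1), of "- c" x] neg[of "c *\<^sub>R x"]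
      by (cases "c \<ge> 0") auto
  qed
  moreover have le: "m x \<le> p x" for x
    using m(2) p0(2)[of x] by (auto simp: le_fun_def intro: order_trans)
  \<comment> \<open>The choice of \<open>p0\<close> gives \<open>m (- y) \<le> - p y\<close>, which
    oddness turns into \<open>p y \<le> m y\<close>.\<close>
  moreover have "m y = p y"
    using le[of y] neg[of y] m(2) p0(3) by (auto simp: le_fun_def dest!: spec[of _ "- y"])
  ultimately show ?thesis
    using that by blast
qed

text \<open>Used with \<open>p\<close> the norm, giving norming functionals, and with
  \<open>p\<close> the distance to a subspace, giving functionals that vanish there.\<close>

lemma functional_below_seminorm:
  fixes p :: "'a::real_normed_vector \<Rightarrow> real"
  assumes p: "sublinear p" and le: "\<And>x. p x \<le> norm x"
  obtains f :: "'a \<Rightarrow>\<^sub>L real" where "\<And>x. f x \<le> p x" "f y = p y" "norm f \<le> 1"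
proof -
  obtain f where f: "linear f" "\<And>x. f x \<le> p x" "f y = p y"
    using Hahn_Banach_sublinear[OF p] by blast
  have ab: "norm (f x) \<le> 1 * norm x" for x
  proof -
    have "f x \<le> norm x" "f (- x) \<le> norm (- x)"
      using f(2) le order_trans by blast+
    then show ?thesis
      using linear_neg[OF f(1), of x] by simp
  qed
  have "bounded_linear f"
    using f(1) ab by (intro bounded_linear_intro[where K = 1]) (auto simp: linear_add linear_scale)
  then have app: "blinfun_apply (Blinfun f) = f"
    by (rule bounded_linear_Blinfun_apply)
  then have "norm (Blinfun f) \<le> 1"
    using ab by (intro norm_blinfun_bound) auto
  then show ?thesis
    using that[of "Blinfun f"] f app by auto
qed

lemma norming_functional:
  fixes y :: "'a::real_normed_vector"
  obtains f :: "'a \<Rightarrow>\<^sub>L real" where "norm f \<le> 1" "f y = norm y"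
  by (rule functional_below_seminorm[of norm y]) (auto simp: sublinear_def norm_triangle_ineq)

section \<open>The modulus of asymptotic uniform smoothness\<close>

text \<open>The norm need not be attained, hence the slack \<open>e\<close>. If every value on the
  ball stayed below \<open>norm A - e\<close>, rescaling would make that number an operator
  bound.\<close>

lemma nearly_norming_vector:
  fixes A :: "'a::real_normed_vector \<Rightarrow>\<^sub>L 'b::real_normed_vector"
  assumes e: "e > 0"
  obtains x where "norm x \<le> 1" "norm A - e \<le> norm (A x)"
proof -
  have "\<exists>x. norm x \<le> 1 \<and> norm A - e \<le> norm (A x)"
  proof (rule ccontr)
    assume "\<nexists>x. norm x \<le> 1 \<and> norm A - e \<le> norm (A x)"
    then have lt: "norm (A x) < norm A - e" if "norm x \<le> 1" for x
      using that by (meson not_le)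
    then have pos: "0 \<le> norm A - e"
      using lt[of 0] by simp
    have "norm (A x) \<le> (norm A - e) * norm x" for x
    proof (cases "x = 0")
      case False
      then have "norm (A (x /\<^sub>R norm x)) < norm A - e"
        by (intro lt) auto
      then show ?thesis
        using False by (simp add: blinfun.scaleR_right field_simps)
    qed auto
    then have "norm A \<le> norm A - e"
      using pos by (rule norm_blinfun_bound[rotated])
    with e show False by simp
  qed
  then show ?thesis using that by blast
qed

lemma nearly_norming_vector_functional:
  fixes f :: "'a::real_normed_vector \<Rightarrow>\<^sub>L real"
  assumes "e > 0"
  obtains x where "norm x \<le> 1" "norm f - e \<le> f x"
proof -
  obtain x where x: "norm x \<le> 1" "norm f - e \<le> norm (f x)"
    using nearly_norming_vector[OF assms] by blast
  then show ?thesis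
    using that[of x] that[of "- x"] by (cases "f x \<ge> 0") (auto simp: blinfun.minus_right)
qed

abbreviation aus_pairs :: "'a::real_normed_vector set \<Rightarrow> real \<Rightarrow> ('a \<times> 'a filter) set" where
  "aus_pairs S \<sigma> \<equiv> {(z, F). z \<in> S \<and> norm z \<le> 1 \<and> F \<noteq> bot \<and>
                       (\<forall>\<^sub>F w in F. w \<in> S \<and> norm w \<le> \<sigma>) \<and> weakly_null_in S F}"

text \<open>The constant net 0 is the source of all lower bounds on the modulus.\<close>

lemma aus_pairs_0:
  assumes S: "0 \<in> S" "z \<in> S" "norm z \<le> 1" and "0 \<le> \<sigma>"
  shows "(z, principal {0}) \<in> aus_pairs S \<sigma>"
proof -
  have "f 0 = 0" if "\<forall>c. \<forall>x\<in>S. f (c *\<^sub>R x) = c * f x" for f :: "'a \<Rightarrow> real"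
    using that S(1) by (metis mult_zero_left scaleR_zero_left)
  then have "weakly_null_in S (principal {0})"
    by (auto simp: weakly_null_in_def intro!: tendsto_eventually simp: eventually_principal)
  then show ?thesis
    using assms by (auto simp: eventually_principal principal_eq_bot_iff)
qed

text \<open>The supremum lies between 0 and \<open>1 + \<sigma>\<close>, so the conversion to a real
  number in \<open>aus_modulus\<close> loses nothing.\<close>

lemma ereal_Limsup_aus_modulus:
  assumes S: "0 \<in> S" and s: "0 \<le> \<sigma>"
  shows "ereal (1 + aus_modulus S \<sigma>)
    = (SUP zF \<in> aus_pairs S \<sigma>. Limsup (snd zF) (\<lambda>w. ereal (norm (fst zF + w))))" (is "_ = ?R")
proof -
  have "?R \<le> ereal (1 + \<sigma>)"
  proof (rule SUP_least, clarify)
    fix z :: 'a and F assume z: "norm z \<le> 1" and F: "\<forall>\<^sub>F w in F. w \<in> S \<and> norm w \<le> \<sigma>"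
    have "\<forall>\<^sub>F w in F. ereal (norm (z + w)) \<le> ereal (1 + \<sigma>)"
      using F by eventually_elim (use z norm_triangle_ineq in \<open>smt (verit) ereal_less_eq(3)\<close>)
    then show "Limsup (snd (z, F)) (\<lambda>w. ereal (norm (fst (z, F) + w))) \<le> ereal (1 + \<sigma>)"
      by (simp add: Limsup_bounded)
  qed
  moreover have "ereal 0 \<le> ?R"
    by (rule SUP_upper2[OF aus_pairs_0[OF S S _ s]])
       (auto intro!: le_Limsup simp: principal_eq_bot_iff)
  ultimately have "\<bar>?R\<bar> \<noteq> \<infinity>"
    by (cases ?R) auto
  then show ?thesis
    unfolding aus_modulus_def by (simp add: ereal_real)
qed

lemma aus_modulus_ge:
  assumes S: "0 \<in> S" and s: "0 \<le> \<sigma>" and zF: "(z, F) \<in> aus_pairs S \<sigma>"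
    and d: "\<exists>\<^sub>F w in F. d \<le> norm (z + w)"
  shows "d \<le> 1 + aus_modulus S \<sigma>"
proof (rule ccontr)
  assume "\<not> d \<le> 1 + aus_modulus S \<sigma>"
  then have less: "ereal (1 + aus_modulus S \<sigma>) < ereal d"
    by simp
  have "Limsup F (\<lambda>w. ereal (norm (z + w))) \<le> ereal (1 + aus_modulus S \<sigma>)"
    unfolding ereal_Limsup_aus_modulus[OF S s] by (rule SUP_upper2[OF zF]) simp
  also note less
  finally have "Limsup F (\<lambda>w. ereal (norm (z + w))) < ereal d" .
  from Limsup_lessD[OF this] have "\<forall>\<^sub>F w in F. \<not> d \<le> norm (z + w)"
    by eventually_elim simp
  with d show False
    by (simp add: frequently_def)
qed

text \<open>Upper bounds need testing only on ultrafilters along which the norms converge. A filter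
  whose upper limit exceeds \<open>1 + r\<close> can be restricted to the vectors with
  \<open>d \<le> norm (z + w)\<close> and refined to an ultrafilter; weak nullity and the bound
  \<open>\<sigma>\<close> are inherited.\<close>

lemma aus_modulus_le:
  assumes S: "0 \<in> S" and s: "0 \<le> \<sigma>"
    and le: "\<And>z U L. ultra U \<Longrightarrow> z \<in> S \<Longrightarrow> norm z \<le> 1 \<Longrightarrow> \<forall>\<^sub>F w in U. w \<in> S \<and> norm w \<le> \<sigma> \<Longrightarrow>
      weakly_null_in S U \<Longrightarrow> ((\<lambda>w. norm (z + w)) \<longlongrightarrow> L) U \<Longrightarrow> L \<le> 1 + r"
  shows "aus_modulus S \<sigma> \<le> r"
proof -
  have "ereal (1 + aus_modulus S \<sigma>) \<le> ereal (1 + r)"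
    unfolding ereal_Limsup_aus_modulus[OF S s]
  proof (rule SUP_least, clarify)
    fix z F assume z: "z \<in> S" "norm z \<le> 1" "F \<noteq> bot" and F: "\<forall>\<^sub>F w in F. w \<in> S \<and> norm w \<le> \<sigma>"
      and null: "weakly_null_in S F"
    have "Limsup F (\<lambda>w. ereal (norm (z + w))) \<le> ereal (1 + r)"
      unfolding Limsup_le_iff
    proof (intro allI impI)
      fix y assume y: "ereal (1 + r) < y"
      show "\<forall>\<^sub>F w in F. ereal (norm (z + w)) < y"
      proof (rule ccontr)
        assume neg: "\<not> ?thesis"
        define d where "d = real_of_ereal y"
        have "y \<noteq> \<infinity>" using neg by auto
        then have yd: "y = ereal d"
          using y unfolding d_def by (cases y) auto
        let ?G = "inf F (principal {w. d \<le> norm (z + w)})"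
        have "?G \<noteq> bot"
          using neg by (auto simp: yd eventually_inf_principal not_le[symmetric] simp flip: eventually_False)
        then obtain U where U: "ultra U" "U \<le> ?G"
          using ex_ultra_le by blast
        then have UF: "U \<le> F" and Ud: "\<forall>\<^sub>F w in U. d \<le> norm (z + w)"
          by (auto simp: le_principal)
        have Us: "\<forall>\<^sub>F w in U. w \<in> S \<and> norm w \<le> \<sigma>"
          using F UF by (simp add: le_filter_def)
        have "\<forall>\<^sub>F w in U. \<bar>norm (z + w)\<bar> \<le> 1 + \<sigma>"
          using Us by eventually_elim (use z norm_triangle_ineq[of z] in \<open>smt (verit) norm_ge_zero\<close>)
        then obtain L where L: "((\<lambda>w. norm (z + w)) \<longlongrightarrow> L) U"
          by (rule ultra_convergent_real[OF U(1)])
        have "weakly_null_in S U"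
          using null tendsto_mono[OF UF] unfolding weakly_null_in_def by blast
        then have "L \<le> 1 + r"
          using le[OF U(1) z(1,2) Us _ L] by blast
        moreover have "d \<le> L"
          using tendsto_lowerbound[OF L Ud] U(1) by (simp add: ultra_def)
        ultimately show False
          using y yd by simp
      qed
    qed
    then show "Limsup (snd (z, F)) (\<lambda>w. ereal (norm (fst (z, F) + w))) \<le> ereal (1 + r)"
      by simp
  qed
  then show ?thesis by simp
qed

lemma aus_modulus_mono:
  assumes S: "0 \<in> S" and st: "0 \<le> \<sigma>" "\<sigma> \<le> \<tau>"
  shows "aus_modulus S \<sigma> \<le> aus_modulus S \<tau>"
proof -
  have "aus_pairs S \<sigma> \<subseteq> aus_pairs S \<tau>"
    using st by (auto elim!: eventually_mono)
  then have "ereal (1 + aus_modulus S \<sigma>) \<le> ereal (1 + aus_modulus S \<tau>)"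
    using st by (simp only: ereal_Limsup_aus_modulus[OF S] order_trans[OF st] SUP_subset_mono order_refl)
  then show ?thesis by simp
qed

lemma aus_modulus_le_self:
  assumes S: "0 \<in> S" and s: "0 \<le> \<sigma>"
  shows "aus_modulus S \<sigma> \<le> \<sigma>"
proof (rule aus_modulus_le[OF S s])
  fix z :: 'a and U L
  assume U: "ultra U" and z: "norm z \<le> 1" and ev: "\<forall>\<^sub>F w in U. w \<in> S \<and> norm w \<le> \<sigma>"
    and L: "((\<lambda>w. norm (z + w)) \<longlongrightarrow> L) U"
  have "\<forall>\<^sub>F w in U. norm (z + w) \<le> 1 + \<sigma>"
    using ev by eventually_elim (use z norm_triangle_ineq[of z] in \<open>smt (verit)\<close>)
  then show "L \<le> 1 + \<sigma>"
    using tendsto_upperbound[OF L] U by (simp add: ultra_def)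
qed

lemma aus_modulus_nonneg:
  assumes S: "0 \<in> S" and z: "z \<in> S" "norm z = 1" and s: "0 \<le> \<sigma>"
  shows "0 \<le> aus_modulus S \<sigma>"
proof -
  have "1 \<le> 1 + aus_modulus S \<sigma>"
    using z by (intro aus_modulus_ge[OF S s aus_pairs_0[OF S z(1) _ s]])
      (auto simp: frequently_def eventually_principal)
  then show ?thesis by simp
qed

text \<open>A degenerate value: over the zero space every upper limit is 0, so subtracting 1 leaves
  -1 instead of 0.\<close>

lemma aus_modulus_trivial:
  assumes S: "S = {0}" and s: "0 \<le> \<sigma>"
  shows "aus_modulus S \<sigma> = - 1"
proof (rule antisym)
  show "aus_modulus S \<sigma> \<le> - 1"
  proof (rule aus_modulus_le)
    fix z :: 'a and U L
    assume U: "ultra U" and z: "z \<in> S" and ev: "\<forall>\<^sub>F w in U. w \<in> S \<and> norm w \<le> \<sigma>"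
      and L: "((\<lambda>w. norm (z + w)) \<longlongrightarrow> L) U"
    have "\<forall>\<^sub>F w in U. norm (z + w) \<le> 0"
      using ev by eventually_elim (use z S in auto)
    then show "L \<le> 1 + - 1"
      using tendsto_upperbound[OF L] U by (simp add: ultra_def)
  qed (use S s in auto)
  have "0 \<le> 1 + aus_modulus S \<sigma>"
    by (rule aus_modulus_ge[OF _ s aus_pairs_0[of S 0]])
       (use S s in \<open>auto simp: frequently_def eventually_principal\<close>)
  then show "- 1 \<le> aus_modulus S \<sigma>" by simp
qed

text \<open>Over the zero space the quotient is \<open>- 1 / \<sigma>\<close>, which does not tend
  to 0. Nontriviality later supplies a compact operator of norm one.\<close>

lemma AUS_nontrivial:
  assumes "AUS (UNIV :: 'a::real_normed_vector set)"
  shows "\<exists>z::'a. z \<noteq> 0"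
proof (rule ccontr)
  assume "\<not> ?thesis"
  then have triv: "(UNIV :: 'a set) = {0}" by auto
  have "\<forall>\<^sub>F \<sigma> in at_right 0. \<bar>aus_modulus (UNIV :: 'a set) \<sigma> / \<sigma>\<bar> < 1"
    using tendstoD[OF assms[unfolded AUS_def], of 1] by (simp add: dist_real_def)
  moreover have "\<forall>\<^sub>F \<sigma> in at_right (0::real). \<sigma> \<in> {0<..<1}"
    by (rule eventually_at_right_real) simp
  ultimately have "\<forall>\<^sub>F \<sigma> in at_right (0::real). False"
  proof eventually_elim
    case (elim \<sigma>)
    then show ?case
      using aus_modulus_trivial[OF triv, of \<sigma>] by (simp add: field_simps)
  qed
  then show False
    by (simp add: eventually_False)
qed

lemma AUF_nontrivial:
  assumes "AUF (UNIV :: 'a::real_normed_vector set)"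
  shows "\<exists>z::'a. z \<noteq> 0"
proof (rule ccontr)
  assume "\<not> ?thesis"
  then have triv: "(UNIV :: 'a set) = {0}" by auto
  obtain \<sigma> where "\<sigma> > 0" "aus_modulus (UNIV :: 'a set) \<sigma> = 0"
    using assms unfolding AUF_def by blast
  then show False
    using aus_modulus_trivial[OF triv, of \<sigma>] by simp
qed

lemma weakly_null_in_UNIV_iff:
  "weakly_null_in (UNIV :: 'a::real_normed_vector set) F \<longleftrightarrow>
    (\<forall>f :: 'a \<Rightarrow>\<^sub>L real. (f \<longlongrightarrow> 0) F)"
proof
  assume null: "weakly_null_in (UNIV :: 'a set) F"
  show "\<forall>f :: 'a \<Rightarrow>\<^sub>L real. (f \<longlongrightarrow> 0) F"
  proof
    fix f :: "'a \<Rightarrow>\<^sub>L real"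
    show "(f \<longlongrightarrow> 0) F"
    proof (rule null[unfolded weakly_null_in_def, rule_format], intro conjI exI[of _ "norm f"])
      show "\<forall>x\<in>UNIV. \<bar>f x\<bar> \<le> norm f * norm x"
        using norm_blinfun[of f] by simp
    qed (simp_all add: blinfun.add_right blinfun.scaleR_right)
  qed
next
  assume null: "\<forall>f :: 'a \<Rightarrow>\<^sub>L real. (f \<longlongrightarrow> 0) F"
  show "weakly_null_in (UNIV :: 'a set) F"
    unfolding weakly_null_in_def
  proof (intro allI impI, elim conjE exE)
    fix f :: "'a \<Rightarrow> real" and C
    assume f: "\<forall>x\<in>UNIV. \<forall>y\<in>UNIV. f (x + y) = f x + f y" "\<forall>c. \<forall>x\<in>UNIV. f (c *\<^sub>R x) = c * f x"
      "\<forall>x\<in>UNIV. \<bar>f x\<bar> \<le> C * norm x"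
    then have "bounded_linear f"
      by (intro bounded_linear_intro[where K = C]) (auto simp: mult.commute)
    then show "(f \<longlongrightarrow> 0) F"
      using null[rule_format, of "Blinfun f"] by (simp add: bounded_linear_Blinfun_apply)
  qed
qed

section \<open>Spaces of compact operators\<close>

text \<open>The two-index net \<open>(s/2) (w i - w j)\<close> is weakly null whatever the vectors \<open>w i\<close> are;
  choosing \<open>w i\<close> to norm \<open>g i - G\<close> turns the modulus of smoothness into a weak-star convexity
  estimate for the dual, without any reflexivity.\<close>

lemma weak_star_aus_estimate:
  fixes g :: "'i \<Rightarrow> 'z::real_normed_vector \<Rightarrow>\<^sub>L real" and G :: "'z \<Rightarrow>\<^sub>L real"
  assumes U: "ultra U" and g: "\<And>i. norm (g i) \<le> 1"
    and lim: "\<And>z. ((\<lambda>i. g i z) \<longlongrightarrow> G z) U"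
    and u: "((\<lambda>i. norm (g i - G)) \<longlongrightarrow> u) U" and s: "0 < s"
  shows "norm G + s * u / 2 \<le> 1 + aus_modulus (UNIV :: 'z set) s"
proof (rule field_le_epsilon)
  have nb: "U \<noteq> bot"
    using U by (simp add: ultra_def)
  fix e' :: real assume "e' > 0"
  \<comment> \<open>The final error is \<open>2 e\<close> from evaluating at \<open>z\<close>, plus
    \<open>s / 2\<close> times \<open>5 e\<close> from the differences
    \<open>w i - w j\<close>.\<close>
  define e where "e = e' / (2 + 5 * s / 2)"
  have e: "e > 0" and e': "e' = (2 + 5 * s / 2) * e"
    using \<open>e' > 0\<close> s by (auto simp: e_def field_simps)
  obtain z where z: "norm z \<le> 1" "norm G - e \<le> G z"
    using nearly_norming_vector_functional[OF e] by blast
  have "\<exists>w. norm w \<le> 1 \<and> norm (g i - G) - e \<le> (g i - G) w" for i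
    using nearly_norming_vector_functional[OF e] by metis
  then obtain w where w: "\<And>i. norm (w i) \<le> 1" "\<And>i. norm (g i - G) - e \<le> (g i - G) (w i)"
    by metis
  define v where "v = (\<lambda>(i, j). (s/2) *\<^sub>R (w i - w j))"
  let ?F = "filtermap v (U \<times>\<^sub>F U)"
  have conv: "\<exists>l. ((\<lambda>i. f (w i)) \<longlongrightarrow> l) U" for f :: "'z \<Rightarrow>\<^sub>L real"
  proof -
    have "\<bar>f (w i)\<bar> \<le> norm f" for i
      using norm_blinfun[of f "w i"] mult_left_mono[OF w(1)[of i] norm_ge_zero[of f]] by simp
    then have "\<forall>\<^sub>F i in U. \<bar>f (w i)\<bar> \<le> norm f"
      by (intro always_eventually allI)
    from ultra_convergent_real[OF U this] show ?thesis
      by blast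
  qed
  have "(z, ?F) \<in> aus_pairs UNIV s"
  proof (clarify, intro conjI)
    show "?F \<noteq> bot"
      using nb by (simp add: filtermap_bot_iff prod_filter_eq_bot)
    have "norm (v ij) \<le> s" for ij
    proof -
      obtain i j where "ij = (i, j)" by (cases ij)
      moreover have "norm (w i - w j) \<le> 2"
        using norm_triangle_ineq4[of "w i" "w j"] w(1)[of i] w(1)[of j] by linarith
      ultimately show ?thesis
        using s by (simp add: v_def)
    qed
    then show "\<forall>\<^sub>F x in ?F. x \<in> UNIV \<and> norm x \<le> s"
      by (simp add: eventually_filtermap)
    show "weakly_null_in UNIV ?F"
      unfolding weakly_null_in_UNIV_iff filterlim_filtermap
    proof
      fix f :: "'z \<Rightarrow>\<^sub>L real"
      obtain l where l: "((\<lambda>i. f (w i)) \<longlongrightarrow> l) U"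
        using conv by blast
      \<comment> \<open>Both coordinates of the product filter give the same limit \<open>l\<close>,
        so the differences are weakly null.\<close>
      have "((\<lambda>ij. (s/2) * (f (w (fst ij)) - f (w (snd ij)))) \<longlongrightarrow> (s/2) * (l - l)) (U \<times>\<^sub>F U)"
        by (intro tendsto_intros filterlim_compose[OF l filterlim_fst] filterlim_compose[OF l filterlim_snd])
      then show "((\<lambda>ij. f (v ij)) \<longlongrightarrow> 0) (U \<times>\<^sub>F U)"
        by (simp add: v_def case_prod_unfold blinfun.scaleR_right blinfun.diff_right)
    qed
  qed (use z in auto)
  moreover have "\<exists>\<^sub>F x in ?F. norm G + s * u / 2 - e' \<le> norm (z + x)"
  proof (rule ccontr)
    assume "\<not> ?thesis"
    then have "\<forall>\<^sub>F ij in U \<times>\<^sub>F U. norm (z + v ij) < norm G + s * u / 2 - e'"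
      by (simp add: frequently_def eventually_filtermap not_le)
    then obtain P Q where P: "eventually P U" and Q: "eventually Q U"
      and PQ: "\<And>i j. P i \<Longrightarrow> Q j \<Longrightarrow> norm (z + v (i, j)) < norm G + s * u / 2 - e'"
      unfolding eventually_prod_filter by blast
    obtain l where l: "((\<lambda>i. G (w i)) \<longlongrightarrow> l) U"
      using conv by blast
    have lev: "\<forall>\<^sub>F i in U. \<bar>G (w i) - l\<bar> < e"
      using tendstoD[OF l e] by (simp add: dist_real_def)
    \<comment> \<open>The order of choice matters: \<open>g i (w j)\<close> is close to
      \<open>G (w j)\<close> only for a fixed \<open>j\<close>, so \<open>i\<close> is chosen
      afterwards.\<close>
    obtain j where j: "Q j" "\<bar>G (w j) - l\<bar> < e"
      using eventually_happens'[OF nb eventually_conj[OF Q lev]] by blast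
    have "\<forall>\<^sub>F i in U. \<bar>g i (w j) - G (w j)\<bar> < e" "\<forall>\<^sub>F i in U. \<bar>g i z - G z\<bar> < e"
      "\<forall>\<^sub>F i in U. \<bar>norm (g i - G) - u\<bar> < e"
      using tendstoD[OF lim e] tendstoD[OF u e] by (simp_all add: dist_real_def)
    with P lev have "\<forall>\<^sub>F i in U. P i \<and> \<bar>G (w i) - l\<bar> < e \<and> \<bar>g i (w j) - G (w j)\<bar> < e
        \<and> \<bar>g i z - G z\<bar> < e \<and> \<bar>norm (g i - G) - u\<bar> < e"
      by eventually_elim simp
    then obtain i where i: "P i" "\<bar>G (w i) - l\<bar> < e" "\<bar>g i (w j) - G (w j)\<bar> < e"
      "\<bar>g i z - G z\<bar> < e" "\<bar>norm (g i - G) - u\<bar> < e"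
      using eventually_happens'[OF nb] by blast
    \<comment> \<open>One \<open>e\<close> each for the choice of \<open>w i\<close>, for
      \<open>norm (g i - G)\<close> against \<open>u\<close>, for \<open>G (w i)\<close> and
      \<open>G (w j)\<close> against \<open>l\<close>, and for \<open>g i (w j)\<close> against
      \<open>G (w j)\<close>.\<close>
    have "u - 5 * e \<le> g i (w i) - g i (w j)"
      using w(2)[of i] i j by (simp add: blinfun.diff_left)
    then have "s/2 * (u - 5 * e) \<le> s/2 * (g i (w i) - g i (w j))"
      using s by (intro mult_left_mono) auto
    moreover have "norm G - 2 * e \<le> g i z"
      using z i by linarith
    ultimately have "norm G + s * u / 2 - e' \<le> g i z + s/2 * (g i (w i) - g i (w j))"
      by (simp add: e' algebra_simps)
    also have "\<dots> = g i (z + v (i, j))"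
      by (simp add: v_def blinfun.add_right blinfun.scaleR_right blinfun.diff_right)
    also have "\<dots> \<le> norm (z + v (i, j))"
      using norm_blinfun[of "g i" "z + v (i, j)"] mult_right_mono[OF g[of i] norm_ge_zero[of "z + v (i, j)"]]
      by simp
    finally show False
      using PQ[OF i(1) j(1)] by simp
  qed
  ultimately have "norm G + s * u / 2 - e' \<le> 1 + aus_modulus (UNIV :: 'z set) s"
    using s by (intro aus_modulus_ge) auto
  then show "norm G + s * u / 2 \<le> 1 + aus_modulus (UNIV :: 'z set) s + e'"
    by simp
qed

section \<open>The bidual and functionals on spaces of operators\<close>

lemma norm_blinfun_le: "norm (blinfun_apply f x) \<le> a * b" if "norm f \<le> a" "norm x \<le> b"
  using norm_blinfun[of f x] mult_mono[OF that order_trans[OF norm_ge_zero that(1)] norm_ge_zero]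
  by linarith

text \<open>The canonical embedding into the bidual, bundled so that \<open>weak_star_limit\<close>
  applies to nets of vectors.\<close>

definition evaluation :: "'a::real_normed_vector \<Rightarrow> ('a \<Rightarrow>\<^sub>L real) \<Rightarrow>\<^sub>L real" where
  "evaluation x = Blinfun (\<lambda>f. blinfun_apply f x)"

lemma evaluation_apply [simp]: "evaluation x f = f x"
  unfolding evaluation_def
  by (subst bounded_linear_Blinfun_apply) (auto intro: blinfun.bounded_linear_left)

lemma norm_evaluation_le: "norm (evaluation x) \<le> norm x"
proof (rule norm_blinfun_bound)
  show "norm (evaluation x f) \<le> norm x * norm f" for f
    using norm_blinfun[of f x] by (simp add: mult.commute)
qed simp

lemma ultra_norm_convergent:
  fixes h :: "'i \<Rightarrow> 'z::real_normed_vector"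
  assumes "ultra U" "\<And>i. norm (h i) \<le> M"
  obtains u where "((\<lambda>i. norm (h i - z)) \<longlongrightarrow> u) U"
proof (rule ultra_convergent_real[OF assms(1), of "\<lambda>i. norm (h i - z)" "M + norm z"])
  have "norm (h i - z) \<le> M + norm z" for i
    using norm_triangle_ineq4[of "h i" z] assms(2)[of i] by linarith
  then show "\<forall>\<^sub>F i in U. \<bar>norm (h i - z)\<bar> \<le> M + norm z"
    by simp
qed

text \<open>The map is the functional \<open>H \<otimes> G\<close>, bounded by
  \<open>norm H * norm G\<close>; through it the weak nullity of the net enters the main
  estimate.\<close>

lemma weakly_null_compact_ops:
  fixes H :: "('a::real_normed_vector \<Rightarrow>\<^sub>L real) \<Rightarrow>\<^sub>L real" and G :: "'b::real_normed_vector \<Rightarrow>\<^sub>L real"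
  assumes "weakly_null_in (compact_ops :: ('a \<Rightarrow>\<^sub>L 'b) set) U"
  shows "((\<lambda>W. H (G o\<^sub>L W)) \<longlongrightarrow> 0) U"
proof (rule assms[unfolded weakly_null_in_def, rule_format], intro conjI exI[of _ "norm H * norm G"] allI ballI)
  fix V W :: "'a \<Rightarrow>\<^sub>L 'b" and c
  show "H (G o\<^sub>L (V + W)) = H (G o\<^sub>L V) + H (G o\<^sub>L W)"
    by (simp add: bounded_bilinear.add_right[OF bounded_bilinear_blinfun_compose] blinfun.add_right)
  show "H (G o\<^sub>L (c *\<^sub>R V)) = c * H (G o\<^sub>L V)"
    by (simp add: bounded_bilinear.scaleR_right[OF bounded_bilinear_blinfun_compose] blinfun.scaleR_right)
  show "\<bar>H (G o\<^sub>L V)\<bar> \<le> norm H * norm G * norm V"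
    using norm_blinfun_le[OF order_refl norm_blinfun_compose, of H G V] by (simp add: mult.assoc)
qed

lemma compact_ops_0: "0 \<in> compact_ops"
  by (auto simp: compact_ops_def image_constant_conv)

text \<open>If \<open>x W\<close> and \<open>y W\<close> norm \<open>T + W\<close> and converge weak-star to \<open>H\<close> and \<open>G\<close>, then
  \<open>\<parallel>T + W\<parallel>\<close> is at most \<open>\<parallel>G\<parallel> \<parallel>H\<parallel> + \<sigma> (u + v)\<close> in the limit, with \<open>u\<close> and \<open>v\<close> the limiting
  distances; these losses are paid for by \<open>weak_star_aus_estimate\<close>.\<close>

theorem aus_modulus_compact_ops:
  fixes \<sigma> :: real
  assumes s: "0 < \<sigma>"
  shows "aus_modulus (compact_ops :: ('a::real_normed_vector \<Rightarrow>\<^sub>L 'b::real_normed_vector) set) \<sigma>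
    \<le> max (aus_modulus (UNIV :: ('a \<Rightarrow>\<^sub>L real) set) (4 * \<sigma>)) (aus_modulus (UNIV :: 'b set) (4 * \<sigma>))"
    (is "_ \<le> max ?RX ?RY")
proof (rule aus_modulus_le[OF compact_ops_0])
  fix T :: "'a \<Rightarrow>\<^sub>L 'b" and U :: "('a \<Rightarrow>\<^sub>L 'b) filter" and L :: real
  assume U: "ultra U" and T: "T \<in> compact_ops" "norm T \<le> 1"
    and small: "\<forall>\<^sub>F W in U. W \<in> compact_ops \<and> norm W \<le> \<sigma>"
    and null: "weakly_null_in compact_ops U" and L: "((\<lambda>W. norm (T + W)) \<longlongrightarrow> L) U"
  have nb: "U \<noteq> bot"
    using U by (simp add: ultra_def)
  show "L \<le> 1 + max ?RX ?RY"
  proof (rule field_le_epsilon)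
    fix e :: real assume e: "e > 0"
    have "\<exists>x. norm x \<le> 1 \<and> norm (T + W) - e \<le> norm ((T + W) x)" for W
      using nearly_norming_vector[OF e] by metis
    then obtain x where x: "\<And>W. norm (x W) \<le> 1" "\<And>W. norm (T + W) - e \<le> norm ((T + W) (x W))"
      by metis
    have "\<exists>y. norm y \<le> 1 \<and> blinfun_apply y ((T + W) (x W)) = norm ((T + W) (x W))" for W
      using norming_functional by metis
    then obtain y :: "_ \<Rightarrow> 'b \<Rightarrow>\<^sub>L real"
      where y: "\<And>W. norm (y W) \<le> 1" "\<And>W. y W ((T + W) (x W)) = norm ((T + W) (x W))"
      by metis
    have ev: "norm (evaluation (x W)) \<le> 1" for W
      using norm_evaluation_le x(1) order_trans by blast
    obtain G :: "'b \<Rightarrow>\<^sub>L real" where G: "\<And>z. ((\<lambda>W. y W z) \<longlongrightarrow> G z) U" "norm G \<le> 1"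
      using weak_star_limit[OF U, of y 1] y(1) by blast
    obtain H :: "('a \<Rightarrow>\<^sub>L real) \<Rightarrow>\<^sub>L real" where "\<And>f. ((\<lambda>W. evaluation (x W) f) \<longlongrightarrow> H f) U" and H1: "norm H \<le> 1"
      using weak_star_limit[OF U, of "\<lambda>W. evaluation (x W)" 1] ev by blast
    then have H: "((\<lambda>W. f (x W)) \<longlongrightarrow> H f) U" for f :: "'a \<Rightarrow>\<^sub>L real"
      by simp
    obtain u where u: "((\<lambda>W. norm (y W - G)) \<longlongrightarrow> u) U"
      using ultra_norm_convergent[OF U, of y 1 G] y(1) by blast
    obtain v where v: "((\<lambda>W. norm (evaluation (x W) - H)) \<longlongrightarrow> v) U"
      using ultra_norm_convergent[OF U, of "\<lambda>W. evaluation (x W)" 1 H] ev by blast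
    \<comment> \<open>The scale \<open>4 * \<sigma>\<close> offsets the factor 1/2 in
      \<open>weak_star_aus_estimate\<close> and leaves \<open>2 * \<sigma>\<close>, so that the
      larger of \<open>u\<close> and \<open>v\<close> can pay for both losses.\<close>
    have Gu: "norm G + 2 * \<sigma> * u \<le> 1 + ?RY"
      using weak_star_aus_estimate[OF U y(1) G(1) u, of "4 * \<sigma>"] s by simp
    have Hv: "norm H + 2 * \<sigma> * v \<le> 1 + ?RX"
      using weak_star_aus_estimate[OF U ev _ v, of "4 * \<sigma>"] H s by simp

    \<comment> \<open>Compactness of \<open>T\<close> turns weak-star convergence of
      \<open>x W\<close> into norm convergence of \<open>T (x W)\<close>, which can be paired with
      the weak-star convergent \<open>y W\<close>.\<close>
    have T_lim: "((\<lambda>W. y W (T (x W))) \<longlongrightarrow> H (G o\<^sub>L T)) U"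
    proof -
      have "compact (closure (blinfun_apply T ` cball 0 1))"
        using T by (simp add: compact_ops_def)
      moreover have "\<forall>\<^sub>F W in U. T (x W) \<in> closure (blinfun_apply T ` cball 0 1)"
        using x(1) by (intro always_eventually) (auto intro!: closure_subset[THEN subsetD])
      ultimately obtain y0 where y0: "((\<lambda>W. T (x W)) \<longlongrightarrow> y0) U"
        by (rule ultra_convergent[OF U])
      have "((\<lambda>W. (y W - G) (T (x W) - y0)) \<longlongrightarrow> 0) U"
      proof (rule Lim_null_comparison[OF always_eventually])
        have "norm (y W - G) \<le> 2" for W
          using norm_triangle_ineq4[of "y W" G] y(1)[of W] G(2) by linarith
        then show "\<forall>W. norm ((y W - G) (T (x W) - y0)) \<le> 2 * norm (T (x W) - y0)"
          by (blast intro: norm_blinfun_le)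
        show "((\<lambda>W. 2 * norm (T (x W) - y0)) \<longlongrightarrow> 0) U"
          by (intro tendsto_mult_right_zero tendsto_norm_zero LIM_zero y0)
      qed
      moreover have "((\<lambda>W. y W y0 - G y0) \<longlongrightarrow> 0) U"
        using G(1)[of y0] by (simp add: LIM_zero_iff)
      moreover note H[of "G o\<^sub>L T"]
      ultimately have "((\<lambda>W. (y W - G) (T (x W) - y0) + (y W y0 - G y0) + (G o\<^sub>L T) (x W))
          \<longlongrightarrow> 0 + 0 + H (G o\<^sub>L T)) U"
        by (intro tendsto_add)
      then show ?thesis
        by (simp add: blinfun.diff_left blinfun.diff_right)
    qed

    have W_le: "\<forall>\<^sub>F W in U. y W (W (x W))
        \<le> \<sigma> * norm (evaluation (x W) - H) + \<sigma> * norm (y W - G) + H (G o\<^sub>L W)"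
      using small
    proof eventually_elim
      case (elim W)
      have "norm (y W o\<^sub>L W) \<le> \<sigma>"
        using norm_blinfun_compose[of "y W" W] mult_mono[OF y(1)[of W] conjunct2[OF elim]] by simp
      then have "norm ((evaluation (x W) - H) (y W o\<^sub>L W)) \<le> norm (evaluation (x W) - H) * \<sigma>"
        by (rule norm_blinfun_le[OF order_refl])
      moreover have "norm ((y W - G) o\<^sub>L W) \<le> norm (y W - G) * \<sigma>"
        using norm_blinfun_compose[of "y W - G" W] mult_left_mono[OF conjunct2[OF elim] norm_ge_zero[of "y W - G"]]
        by linarith
      then have "norm (H ((y W - G) o\<^sub>L W)) \<le> 1 * (norm (y W - G) * \<sigma>)"
        by (rule norm_blinfun_le[OF H1])
      \<comment> \<open>First \<open>x W\<close> is replaced by \<open>H\<close>, then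
        \<open>y W\<close> by \<open>G\<close>; each replacement costs \<open>\<sigma>\<close> times
        the corresponding distance.\<close>
      moreover have "y W (W (x W))
          = (evaluation (x W) - H) (y W o\<^sub>L W) + H ((y W - G) o\<^sub>L W) + H (G o\<^sub>L W)"
        by (simp add: blinfun.diff_left bounded_bilinear.diff_left[OF bounded_bilinear_blinfun_compose]
            blinfun.diff_right)
      ultimately show ?case
        by (simp add: mult.commute)
    qed

    have "L - e \<le> H (G o\<^sub>L T) + (\<sigma> * v + \<sigma> * u + 0)"
    proof (rule tendsto_le[OF nb])
      show "((\<lambda>W. norm (T + W) - e) \<longlongrightarrow> L - e) U"
        by (intro tendsto_intros L)
      show "((\<lambda>W. y W (T (x W)) + (\<sigma> * norm (evaluation (x W) - H) + \<sigma> * norm (y W - G) + H (G o\<^sub>L W)))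
          \<longlongrightarrow> H (G o\<^sub>L T) + (\<sigma> * v + \<sigma> * u + 0)) U"
        by (intro tendsto_add tendsto_mult tendsto_const T_lim u v weakly_null_compact_ops null)
      show "\<forall>\<^sub>F W in U. norm (T + W) - e
          \<le> y W (T (x W)) + (\<sigma> * norm (evaluation (x W) - H) + \<sigma> * norm (y W - G) + H (G o\<^sub>L W))"
        using W_le
      proof eventually_elim
        case (elim W)
        then show ?case
          using x(2)[of W] y(2)[of W] by (simp add: blinfun.add_left blinfun.add_right)
      qed
    qed
    moreover have "H (G o\<^sub>L T) \<le> norm H * norm G"
    proof -
      have "norm (G o\<^sub>L T) \<le> norm G"
        using norm_blinfun_compose[of G T] mult_left_mono[OF T(2) norm_ge_zero[of G]] by simp
      then show ?thesis
        using norm_blinfun_le[OF order_refl, of "G o\<^sub>L T" "norm G" H] by simp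
    qed
    \<comment> \<open>The product is bounded by whichever factor goes with the larger of
      \<open>u\<close> and \<open>v\<close>; then \<open>\<sigma> * (u + v)\<close> is at most twice
      that loss.\<close>
    moreover have "norm H * norm G \<le> norm H" "norm H * norm G \<le> norm G"
      using G(2) H1 by (simp_all add: mult_left_le mult_left_le_one_le)
    moreover have "\<sigma> * v \<le> \<sigma> * u \<or> \<sigma> * u \<le> \<sigma> * v"
      by linarith
    ultimately show "L \<le> 1 + max ?RX ?RY + e"
      using Gu Hv by (auto simp: max_def)
  qed
qed (use s in auto)

section \<open>Rank-one operators and nontriviality of the operator space\<close>

lemma rank_one_compact_op:
  fixes f :: "'a::real_normed_vector \<Rightarrow>\<^sub>L real" and y :: "'b::real_normed_vector"
  shows "blinfun_scaleR_left y o\<^sub>L f \<in> compact_ops"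
proof -
  let ?T = "blinfun_scaleR_left y o\<^sub>L f"
  let ?K = "(\<lambda>t. t *\<^sub>R y) ` {- norm f..norm f}"
  have K: "compact ?K"
    by (intro compact_continuous_image continuous_intros) auto
  have "blinfun_apply ?T ` cball 0 1 \<subseteq> ?K"
  proof clarify
    fix x :: 'a assume "x \<in> cball 0 1"
    then have "\<bar>f x\<bar> \<le> norm f"
      using norm_blinfun_le[OF order_refl, of x 1 f] by simp
    then show "?T x \<in> ?K"
      by (auto intro!: image_eqI[where x = "f x"])
  qed
  then have "closure (blinfun_apply ?T ` cball 0 1) \<subseteq> ?K"
    using K by (simp add: closure_minimal compact_imp_closed)
  then show ?thesis
    using closed_Int_compact[OF closed_closure K, of "blinfun_apply ?T ` cball 0 1"]
    by (simp add: compact_ops_def Int_absorb2)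
qed

lemma compact_ops_norm_1:
  fixes f :: "'a::real_normed_vector \<Rightarrow>\<^sub>L real" and y :: "'b::real_normed_vector"
  assumes "f \<noteq> 0" "y \<noteq> 0"
  obtains T :: "'a \<Rightarrow>\<^sub>L 'b" where "T \<in> compact_ops" "norm T = 1"
proof -
  let ?R = "blinfun_scaleR_left y o\<^sub>L f"
  obtain x where "f x \<noteq> 0"
    using assms(1) by (metis blinfun_eqI zero_blinfun.rep_eq)
  then have "?R x \<noteq> 0"
    using assms(2) by simp
  then have "?R \<noteq> 0"
    by (metis zero_blinfun.rep_eq)
  \<comment> \<open>Absorbing the normalisation into \<open>y\<close> keeps the operator of rank-one
    form.\<close>
  moreover have "?R /\<^sub>R norm ?R = blinfun_scaleR_left (y /\<^sub>R norm ?R) o\<^sub>L f"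
    by (rule blinfun_eqI) (simp add: scaleR_blinfun.rep_eq mult.commute)
  then have "?R /\<^sub>R norm ?R \<in> compact_ops"
    using rank_one_compact_op by metis
  ultimately show ?thesis
    using that[of "?R /\<^sub>R norm ?R"] by simp
qed

section \<open>Asymptotic uniform convexity and duality\<close>

lemma infdist_approx:
  assumes "E \<noteq> {}" "e > 0"
  obtains a where "a \<in> E" "dist x a < infdist x E + e"
proof -
  have "\<exists>a\<in>E. dist x a < infdist x E + e"
  proof (rule ccontr)
    assume "\<not> ?thesis"
    then have "infdist x E + e \<le> infdist x E"
      unfolding infdist_notempty[OF assms(1)] using assms(1)
      by (intro cINF_greatest) (auto simp: not_less infdist_notempty)
    with assms(2) show False by simp
  qed
  then show ?thesis using that by blast
qed

lemma sublinear_infdist: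
  fixes E :: "'a::real_normed_vector set"
  assumes E: "subspace E"
  shows "sublinear (\<lambda>x. infdist x E)"
proof -
  have ne: "E \<noteq> {}"
    using subspace_0[OF E] by auto
  have "infdist (x + y) E \<le> infdist x E + infdist y E" for x y
  proof (rule field_le_epsilon)
    fix e :: real assume "e > 0"
    then have "e/2 > 0" by simp
    obtain a where a: "a \<in> E" "dist x a < infdist x E + e/2"
      by (rule infdist_approx[OF ne \<open>e/2 > 0\<close>])
    obtain b where b: "b \<in> E" "dist y b < infdist y E + e/2"
      by (rule infdist_approx[OF ne \<open>e/2 > 0\<close>])
    have "infdist (x + y) E \<le> dist (x + y) (a + b)"
      using a b E by (intro infdist_le) (simp add: subspace_add)
    also have "\<dots> \<le> dist x a + dist y b"
      by (rule dist_triangle_add)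
    finally show "infdist (x + y) E \<le> infdist x E + infdist y E + e"
      using a b by simp
  qed
  moreover have "infdist (c *\<^sub>R x) E \<le> c * infdist x E" if c: "c > 0" for c x
  proof (rule field_le_epsilon)
    fix e :: real assume "e > 0"
    then obtain a where a: "a \<in> E" "dist x a < infdist x E + e/c"
      using infdist_approx[OF ne, of "e/c" x] c by auto
    have "infdist (c *\<^sub>R x) E \<le> dist (c *\<^sub>R x) (c *\<^sub>R a)"
      using a E by (intro infdist_le) (simp add: subspace_scale)
    also have "\<dots> = c * dist x a"
      using c by (simp add: dist_norm flip: scaleR_diff_right)
    also have "\<dots> \<le> c * (infdist x E + e/c)"
      using a c by simp
    finally show "infdist (c *\<^sub>R x) E \<le> c * infdist x E + e"
      using c by (simp add: algebra_simps)
  qed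
  ultimately show ?thesis
    by (simp add: sublinear_def)
qed

text \<open>Take \<open>f\<close> dominated by the distance to \<open>E\<close> and equal to it at
  \<open>b\<close>. It vanishes on \<open>E\<close>, so \<open>\<bar>f\<bar>\<close> dominates that
  distance on the span of \<open>E\<close> and \<open>b\<close>; moving \<open>v\<close> to a nearby
  point of the span costs the gap twice.\<close>

lemma infdist_add_span:
  fixes E :: "'a::real_normed_vector set"
  assumes E: "subspace E"
  obtains f :: "'a \<Rightarrow>\<^sub>L real" where "\<And>v. infdist v E \<le> \<bar>f v\<bar> + 2 * infdist v (span (insert b E))"
proof -
  note sub = sublinear_infdist[OF E]
  obtain f :: "'a \<Rightarrow>\<^sub>L real" where f: "\<And>x. f x \<le> infdist x E" "f b = infdist b E" "norm f \<le> 1"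
    by (rule functional_below_seminorm[OF sub, of b])
       (use infdist_le[OF subspace_0[OF E]] in auto)
  have "infdist v E \<le> \<bar>f v\<bar> + 2 * infdist v (span (insert b E))" for v
  proof (rule field_le_epsilon)
    fix e :: real assume "e > 0"
    then obtain r where r: "r \<in> span (insert b E)" "dist v r < infdist v (span (insert b E)) + e/2"
      using infdist_approx[of "span (insert b E)" "e/2" v] span_0 by (metis empty_iff half_gt_zero)
    then obtain t where t: "r - t *\<^sub>R b \<in> E"
      using E by (auto simp: span_breakdown_eq span_eq_iff[THEN iffD2])
    define a where "a = r - t *\<^sub>R b"
    have ra: "r = a + t *\<^sub>R b" and a: "a \<in> E" "- a \<in> E"
      using t E by (simp_all add: a_def subspace_neg del: minus_diff_eq)
    have "f a = 0"
      using f(1)[of a] f(1)[of "- a"] a by (simp add: blinfun.minus_right)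
    then have fr: "f r = t * infdist b E"
      by (simp add: ra blinfun.add_right blinfun.scaleR_right f(2))
    \<comment> \<open>Sublinearity covers nonnegative scalars only; symmetry handles
      \<open>t < 0\<close>.\<close>
    have neg: "infdist (- b) E = infdist b E"
    proof (rule antisym)
      have *: "infdist (- c) E \<le> infdist c E" for c
      proof (rule field_le_epsilon)
        fix d :: real assume "d > 0"
        then obtain z where z: "z \<in> E" "dist c z < infdist c E + d"
          using infdist_approx[of E d c] a by blast
        have "infdist (- c) E \<le> dist (- c) (- z)"
          using z E by (intro infdist_le) (simp add: subspace_neg)
        then show "infdist (- c) E \<le> infdist c E + d"
          using z by (simp add: dist_minus)
      qed
      show "infdist (- b) E \<le> infdist b E" "infdist b E \<le> infdist (- b) E"
        using *[of b] *[of "- b"] by simp_all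
    qed
    have "infdist (t *\<^sub>R b) E = \<bar>t\<bar> * infdist b E"
      using sublinear_scaleR[OF sub, of "\<bar>t\<bar>" b] sublinear_scaleR[OF sub, of "\<bar>t\<bar>" "- b"] neg
      by (cases "t \<ge> 0") auto
    then have "infdist r E \<le> \<bar>f r\<bar>"
      using sublinear_add[OF sub, of a "t *\<^sub>R b"] a fr by (simp add: ra abs_mult infdist_nonneg)
    moreover have "\<bar>f r\<bar> \<le> \<bar>f v\<bar> + dist v r"
      using norm_blinfun_le[OF f(3) order_refl, of "v - r"] by (simp add: blinfun.diff_right dist_norm)
    moreover have "infdist v E \<le> infdist r E + dist v r"
      by (rule infdist_triangle)
    ultimately show "infdist v E \<le> \<bar>f v\<bar> + 2 * infdist v (span (insert b E)) + e"
      using r by linarith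
  qed
  then show ?thesis using that by blast
qed

text \<open>Induction on the complement \<open>B\<close>: moving \<open>b\<close> into the subspace
  costs one functional, which tends to 0 along the net, and a factor 2.\<close>

lemma weakly_null_infdist:
  fixes E :: "'a::real_normed_vector set" and h :: "'i \<Rightarrow> 'a"
  assumes "finite B" "subspace E" "span (E \<union> B) = UNIV"
    and h: "\<And>f :: 'a \<Rightarrow>\<^sub>L real. ((\<lambda>i. f (h i)) \<longlongrightarrow> 0) F"
  shows "((\<lambda>i. infdist (h i) E) \<longlongrightarrow> 0) F"
  using assms(1-3)
proof (induction B arbitrary: E)
  case empty
  then have "E = UNIV"
    by (simp add: span_eq_iff[THEN iffD2])
  then show ?case by simp
next
  case (insert b B)
  obtain f :: "'a \<Rightarrow>\<^sub>L real"
    where f: "\<And>v. infdist v E \<le> \<bar>f v\<bar> + 2 * infdist v (span (insert b E))"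
    using infdist_add_span[OF insert.prems(1)] by blast
  have "E \<union> insert b B \<subseteq> span (insert b E) \<union> B"
    by (auto intro: span_base)
  then have "span (span (insert b E) \<union> B) = UNIV"
    using span_mono[of "E \<union> insert b B"] insert.prems(2) by blast
  then have IH: "((\<lambda>i. infdist (h i) (span (insert b E))) \<longlongrightarrow> 0) F"
    by (intro insert.IH) auto
  show ?case
  proof (rule Lim_null_comparison[OF always_eventually])
    show "\<forall>i. norm (infdist (h i) E) \<le> \<bar>f (h i)\<bar> + 2 * infdist (h i) (span (insert b E))"
      using f by (simp add: infdist_nonneg)
    show "((\<lambda>i. \<bar>f (h i)\<bar> + 2 * infdist (h i) (span (insert b E))) \<longlongrightarrow> 0) F"
      using tendsto_add[OF tendsto_rabs_zero[OF h] tendsto_mult_right_zero[OF IH]] by simp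
  qed
qed

section \<open>Asymptotic uniform convexity of a space and smoothness of its dual\<close>

lemma auc_subspace:
  fixes e :: "'a::real_normed_vector"
  assumes auc: "ereal \<kappa> < auc_modulus TYPE('a) \<tau>" and e: "norm e = 1"
  obtains E where "fin_codim_subspace E"
    "\<And>y. y \<in> E \<Longrightarrow> norm y = 1 \<Longrightarrow> 1 + \<kappa> \<le> norm (e + \<tau> *\<^sub>R y)"
proof -
  define A where "A x E = (INF y \<in> E \<inter> sphere 0 1. ereal (norm (x + \<tau> *\<^sub>R y)))" for x :: 'a and E
  define I where "I = (INF x \<in> sphere (0::'a) 1. SUP E \<in> {E. fin_codim_subspace E}. A x E)"
  have "ereal \<kappa> < I - 1"
    using auc by (simp add: auc_modulus_def I_def A_def)
  then have "ereal (1 + \<kappa>) < I"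
    by (cases I) (auto simp: one_ereal_def)
  also have "I \<le> (SUP E \<in> {E. fin_codim_subspace E}. A e E)"
    unfolding I_def using e by (intro INF_lower) simp
  \<comment> \<open>The strict inequality allows a single subspace to be extracted from the
    supremum.\<close>
  finally obtain E where E: "fin_codim_subspace E" "ereal (1 + \<kappa>) < A e E"
    by (auto simp: less_SUP_iff)
  have "1 + \<kappa> \<le> norm (e + \<tau> *\<^sub>R y)" if "y \<in> E" "norm y = 1" for y
  proof -
    have "A e E \<le> ereal (norm (e + \<tau> *\<^sub>R y))"
      unfolding A_def using that by (intro INF_lower) simp
    with E(2) have "ereal (1 + \<kappa>) < ereal (norm (e + \<tau> *\<^sub>R y))"
      by (rule order.strict_trans2)
    then show ?thesis by simp
  qed
  then show ?thesis using that E by blast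
qed

text \<open>Beyond the radius \<open>\<tau> \<parallel>x0\<parallel>\<close> the convex function \<open>t \<mapsto> \<parallel>x0 + t y\<parallel>\<close> grows at least with
  slope \<open>\<kappa> / \<tau>\<close>; within that radius the estimate is trivial.\<close>

lemma auc_estimate:
  fixes x :: "'i \<Rightarrow> 'a::real_normed_vector"
  assumes nb: "F \<noteq> bot" and x: "\<And>i. norm (x i) \<le> 1" and x0: "norm x0 \<le> 1"
    and weak: "\<And>f :: 'a \<Rightarrow>\<^sub>L real. ((\<lambda>i. f (x i)) \<longlongrightarrow> f x0) F"
    and v: "((\<lambda>i. norm (x i - x0)) \<longlongrightarrow> v) F"
    and tau: "0 < \<tau>" "0 \<le> \<kappa>" "\<kappa> \<le> \<tau>" and auc: "ereal \<kappa> < auc_modulus TYPE('a) \<tau>"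
  shows "norm x0 + \<kappa> / \<tau> * v \<le> 1 + \<kappa>"
proof -
  define \<sigma> where "\<sigma> = \<kappa> / \<tau>"
  have \<sigma>: "0 \<le> \<sigma>" "\<sigma> \<le> 1" "\<sigma> * \<tau> = \<kappa>"
    using tau by (simp_all add: \<sigma>_def)
  have "norm x0 + \<sigma> * v \<le> 1 + \<kappa>"
  proof (cases "x0 = 0")
    case True
    have "v \<le> 1"
      using tendsto_upperbound[OF v always_eventually nb, of 1] x True by simp
    then have "\<sigma> * v \<le> 1"
      using mult_left_mono[of v 1 \<sigma>] \<sigma> by linarith
    then show ?thesis
      using True tau by simp
  next
    case False
    then have N: "norm x0 > 0" by simp
    show ?thesis
    proof (cases "v \<le> \<tau> * norm x0")
      case True
      then have "\<sigma> * v \<le> \<kappa> * norm x0"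
        using mult_left_mono[OF True \<sigma>(1)] \<sigma>(3) by (simp flip: mult.assoc)
      also have "\<dots> \<le> \<kappa>"
        using tau x0 by (simp add: mult_left_le)
      finally show ?thesis
        using x0 by simp
    next
      case False
      obtain E where E: "fin_codim_subspace E"
        "\<And>y. y \<in> E \<Longrightarrow> norm y = 1 \<Longrightarrow> 1 + \<kappa> \<le> norm (x0 /\<^sub>R norm x0 + \<tau> *\<^sub>R y)"
        using auc_subspace[OF auc, of "x0 /\<^sub>R norm x0"] N by auto
      have subE: "subspace E"
        using E by (simp add: fin_codim_subspace_def)
      have grow: "norm x0 + \<sigma> * norm y \<le> norm (x0 + y)" if y: "y \<in> E" "\<tau> * norm x0 \<le> norm y" for y
      proof -
        have ypos: "norm y > 0"
          using y N tau by (smt (verit) mult_pos_pos)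
        \<comment> \<open>With this weight the convexity test point
          \<open>x0 / norm x0 + \<tau> y / norm y\<close> is a convex combination of
          \<open>x0 / norm x0\<close> and \<open>(x0 + y) / norm x0\<close>.\<close>
        define \<theta> where "\<theta> = \<tau> * norm x0 / norm y"
        have \<theta>: "0 < \<theta>" "\<theta> \<le> 1"
          using ypos N tau y by (simp_all add: \<theta>_def)
        have "1 + \<kappa> \<le> norm (x0 /\<^sub>R norm x0 + \<tau> *\<^sub>R (y /\<^sub>R norm y))"
          using y ypos subE by (intro E) (auto simp: subspace_scale)
        also have "x0 /\<^sub>R norm x0 + \<tau> *\<^sub>R (y /\<^sub>R norm y)
            = (1 - \<theta>) *\<^sub>R (x0 /\<^sub>R norm x0) + (\<theta> / norm x0) *\<^sub>R (x0 + y)"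
          using N ypos by (simp add: \<theta>_def algebra_simps divide_inverse)
        also have "norm \<dots> \<le> norm ((1 - \<theta>) *\<^sub>R (x0 /\<^sub>R norm x0)) + norm ((\<theta> / norm x0) *\<^sub>R (x0 + y))"
          by (rule norm_triangle_ineq)
        also have "\<dots> = 1 - \<theta> + \<theta> / norm x0 * norm (x0 + y)"
          using \<theta> N by simp
        finally have "\<theta> + \<kappa> \<le> \<theta> / norm x0 * norm (x0 + y)"
          by simp
        then have "(norm x0 / \<theta>) * (\<theta> + \<kappa>) \<le> (norm x0 / \<theta>) * (\<theta> / norm x0 * norm (x0 + y))"
          using N \<theta> by (intro mult_left_mono) auto
        moreover have "(norm x0 / \<theta>) * (\<theta> / norm x0 * norm (x0 + y)) = norm (x0 + y)"
          using N \<theta> by simp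
        moreover have "(norm x0 / \<theta>) * (\<theta> + \<kappa>) = norm x0 + norm x0 / \<theta> * \<kappa>"
          using \<theta> by (simp add: field_simps)
        moreover have "norm x0 / \<theta> * \<kappa> = \<sigma> * norm y"
          using N tau ypos by (simp add: \<theta>_def \<sigma>_def field_simps)
        ultimately show ?thesis by simp
      qed
      have dist0: "((\<lambda>i. infdist (x i - x0) E) \<longlongrightarrow> 0) F"
      proof -
        obtain B where "finite B" "span (E \<union> B) = UNIV"
          using E(1) by (auto simp: fin_codim_subspace_def)
        moreover have "((\<lambda>i. f (x i - x0)) \<longlongrightarrow> 0) F" for f :: "'a \<Rightarrow>\<^sub>L real"
          using weak[of f] by (simp add: blinfun.diff_right LIM_zero_iff)
        ultimately show ?thesis
          using subE by (intro weakly_null_infdist)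
      qed
      show ?thesis
      proof (rule field_le_epsilon)
        fix e' :: real assume "e' > 0"
        \<comment> \<open>The second entry keeps \<open>norm y \<ge> v - 3 * e\<close> beyond the
          radius where \<open>grow\<close> applies; the first covers the total error
          \<open>2 * e + 3 * \<sigma> * e \<le> 5 * e\<close>.\<close>
        define e where "e = min (e' / 5) ((v - \<tau> * norm x0) / 3)"
        have e: "e > 0" "5 * e \<le> e'" "\<tau> * norm x0 \<le> v - 3 * e"
          using \<open>e' > 0\<close> False by (auto simp: e_def min_def field_simps)
        have "\<forall>\<^sub>F i in F. \<bar>norm (x i - x0) - v\<bar> < e" "\<forall>\<^sub>F i in F. \<bar>infdist (x i - x0) E\<bar> < e"
          using tendstoD[OF v e(1)] tendstoD[OF dist0 e(1)] by (simp_all add: dist_real_def)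
        from eventually_happens'[OF nb eventually_conj[OF this]]
        obtain i where i: "\<bar>norm (x i - x0) - v\<bar> < e" "infdist (x i - x0) E < e"
          by auto
        obtain y where "y \<in> E" "dist (x i - x0) y < infdist (x i - x0) E + e"
          using infdist_approx[of E e "x i - x0"] e(1) subspace_0[OF subE] by blast
        then have y: "y \<in> E" "norm (x i - x0 - y) < 2 * e"
          using i by (auto simp: dist_norm)
        have "norm (x i - x0) \<le> norm y + norm (x i - x0 - y)"
          using norm_triangle_ineq[of y "x i - x0 - y"] by simp
        then have ny: "v - 3 * e \<le> norm y"
          using y i by linarith
        have "norm (x0 + y) \<le> norm (x i) + norm (x i - x0 - y)"
          using norm_triangle_ineq4[of "x i" "x i - x0 - y"] by (simp add: add.commute)
        then have "norm x0 + \<sigma> * norm y \<le> 1 + 2 * e"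
          using grow[OF y(1)] ny e(3) x[of i] y(2) by linarith
        moreover have "\<sigma> * (v - 3 * e) \<le> \<sigma> * norm y"
          using ny \<sigma> by (intro mult_left_mono)
        moreover have "\<sigma> * e \<le> e"
          using \<sigma> e by (simp add: mult_left_le_one_le)
        ultimately show "norm x0 + \<sigma> * v \<le> 1 + \<kappa> + e'"
          using e(2) tau(2) by (simp add: algebra_simps)
      qed
    qed
  qed
  then show ?thesis
    by (simp add: \<sigma>_def)
qed

text \<open>Almost norming vectors \<open>x g\<close> of \<open>f + g\<close> have a weak limit
  \<open>x0\<close> by reflexivity. Then \<open>g x0\<close> tends to 0, and
  \<open>g (x g - x0)\<close> is at most \<open>\<kappa> / \<tau>\<close> times the distance,
  exactly the loss that \<open>auc_estimate\<close> absorbs.\<close>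

lemma aus_modulus_dual_of_auc:
  assumes refl: "reflexive_space TYPE('a::real_normed_vector)"
    and tau: "0 < \<tau>" "0 \<le> \<kappa>" "\<kappa> \<le> \<tau>" and auc: "ereal \<kappa> < auc_modulus TYPE('a) \<tau>"
  shows "aus_modulus (UNIV :: ('a \<Rightarrow>\<^sub>L real) set) (\<kappa> / \<tau>) \<le> \<kappa>"
proof (rule aus_modulus_le)
  show "0 \<le> \<kappa> / \<tau>"
    using tau by simp
  fix f :: "'a \<Rightarrow>\<^sub>L real" and U L
  assume U: "ultra U" and f: "norm f \<le> 1" and small: "\<forall>\<^sub>F g in U. g \<in> UNIV \<and> norm g \<le> \<kappa> / \<tau>"
    and null: "weakly_null_in UNIV U" and L: "((\<lambda>g. norm (f + g)) \<longlongrightarrow> L) U"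
  have nb: "U \<noteq> bot"
    using U by (simp add: ultra_def)
  show "L \<le> 1 + \<kappa>"
  proof (rule field_le_epsilon)
    fix e :: real assume e: "e > 0"
    have "\<exists>x. norm x \<le> 1 \<and> norm (f + g) - e \<le> (f + g) x" for g
      using nearly_norming_vector_functional[OF e] by metis
    then obtain x where x: "\<And>g. norm (x g) \<le> 1" "\<And>g. norm (f + g) - e \<le> (f + g) (x g)"
      by metis
    have ev: "norm (evaluation (x g)) \<le> 1" for g
      using norm_evaluation_le x(1) order_trans by blast
    obtain H :: "('a \<Rightarrow>\<^sub>L real) \<Rightarrow>\<^sub>L real" where H: "\<And>h. ((\<lambda>g. evaluation (x g) h) \<longlongrightarrow> H h) U"
        "norm H \<le> 1"
      using weak_star_limit[OF U, of "\<lambda>g. evaluation (x g)" 1] ev by blast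
    obtain x0 where x0: "\<And>h. H h = blinfun_apply h x0"
      using refl unfolding reflexive_space_def by blast
    have weak: "((\<lambda>g. h (x g)) \<longlongrightarrow> h x0) U" for h :: "'a \<Rightarrow>\<^sub>L real"
      using H(1)[of h] by (simp add: x0)
    have nx0: "norm x0 \<le> 1"
    proof -
      obtain h :: "'a \<Rightarrow>\<^sub>L real" where h: "norm h \<le> 1" "h x0 = norm x0"
        using norming_functional by blast
      then show ?thesis
        using norm_blinfun_le[OF H(2) h(1)] by (simp add: x0)
    qed
    obtain v where v: "((\<lambda>g. norm (x g - x0)) \<longlongrightarrow> v) U"
      using ultra_norm_convergent[OF U, of x 1 x0] x(1) by blast
    have "L - e \<le> f x0 + (0 + \<kappa> / \<tau> * v)"
    proof (rule tendsto_le[OF nb])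
      show "((\<lambda>g. norm (f + g) - e) \<longlongrightarrow> L - e) U"
        by (intro tendsto_intros L)
      have "((\<lambda>g. evaluation x0 g) \<longlongrightarrow> 0) U"
        using null by (simp only: weakly_null_in_UNIV_iff)
      then show "((\<lambda>g. f (x g) + (g x0 + \<kappa> / \<tau> * norm (x g - x0))) \<longlongrightarrow> f x0 + (0 + \<kappa> / \<tau> * v)) U"
        by (intro tendsto_add tendsto_mult tendsto_const weak v) simp
      show "\<forall>\<^sub>F g in U. norm (f + g) - e \<le> f (x g) + (g x0 + \<kappa> / \<tau> * norm (x g - x0))"
        using small
      proof eventually_elim
        case (elim g)
        then have "norm (g (x g - x0)) \<le> \<kappa> / \<tau> * norm (x g - x0)"
          by (intro norm_blinfun_le) auto
        then show ?case
          using x(2)[of g] by (simp add: blinfun.add_left blinfun.diff_right)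
      qed
    qed
    moreover have "f x0 \<le> norm x0"
      using norm_blinfun_le[OF f order_refl, of x0] by simp
    moreover have "norm x0 + \<kappa> / \<tau> * v \<le> 1 + \<kappa>"
      by (rule auc_estimate[OF nb x(1) nx0 weak v tau auc])
    ultimately show "L \<le> 1 + \<kappa> + e"
      by linarith
  qed
qed simp

text \<open>Supplies the hypothesis on the dual in the reflexive case, by optimising
  \<open>\<tau>\<close> for each \<open>\<sigma>\<close>.\<close>

lemma p_AUS_dual_of_q_AUC:
  assumes refl: "reflexive_space TYPE('a::real_normed_vector)" and auc: "q_AUC q TYPE('a)"
    and p: "1 < p" and pq: "1 / p + 1 / q = 1"
  shows "p_AUS p (UNIV :: ('a \<Rightarrow>\<^sub>L real) set)"
proof -
  have "1 / q = (p - 1) / p"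
    using pq p by (simp add: field_simps)
  then have q: "q = p / (p - 1)"
    using p by (metis inverse_divide inverse_eq_divide inverse_inverse_eq)
  have q1: "1 < q" and pq1: "(p - 1) * (q - 1) = 1"
    using p by (simp_all add: q field_simps)
  obtain c where c: "c > 0" "\<And>\<tau>. 0 < \<tau> \<Longrightarrow> \<tau> \<le> 1 \<Longrightarrow> ereal (c * \<tau> powr q) \<le> auc_modulus TYPE('a) \<tau>"
    using auc unfolding q_AUC_def by blast
  \<comment> \<open>Being below \<open>c\<close> makes the convexity bound strict; being at most 1
    ensures \<open>\<kappa> = \<sigma> * \<tau> \<le> \<tau>\<close> when
    \<open>\<sigma> \<le> c1\<close>.\<close>
  define c1 where "c1 = min (c / 2) 1"
  have c1: "0 < c1" "c1 < c" "c1 \<le> 1"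
    using c(1) by (auto simp: c1_def min_def)
  have "aus_modulus (UNIV :: ('a \<Rightarrow>\<^sub>L real) set) \<sigma> / \<sigma> powr p \<le> c1 powr (1 - p)" if s: "\<sigma> > 0" for \<sigma>
  proof -
    have "aus_modulus (UNIV :: ('a \<Rightarrow>\<^sub>L real) set) \<sigma> \<le> c1 powr (1 - p) * \<sigma> powr p"
    proof (cases "\<sigma> \<le> c1")
      case True
      \<comment> \<open>The solution of \<open>c1 * \<tau> powr q = \<sigma> * \<tau>\<close>, so
        that the scale \<open>\<kappa> / \<tau>\<close> becomes \<open>\<sigma>\<close>.\<close>
      define \<tau> where "\<tau> = (\<sigma> / c1) powr (p - 1)"
      have tau: "0 < \<tau>" "\<tau> \<le> 1"
        using s c1 True p by (simp_all add: \<tau>_def powr_le1)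
      have "\<tau> powr (q - 1) = \<sigma> / c1"
        using s c1 by (simp add: \<tau>_def powr_powr pq1)
      then have \<kappa>: "c1 * \<tau> powr q = \<sigma> * \<tau>"
        using powr_add[of \<tau> "q - 1" 1] tau c1 by (simp add: field_simps)
      have "ereal (\<sigma> * \<tau>) < ereal (c * \<tau> powr q)"
        using c1 tau by (simp flip: \<kappa>)
      then have "ereal (\<sigma> * \<tau>) < auc_modulus TYPE('a) \<tau>"
        using c(2)[OF tau] by (rule order.strict_trans2)
      then have "aus_modulus (UNIV :: ('a \<Rightarrow>\<^sub>L real) set) (\<sigma> * \<tau> / \<tau>) \<le> \<sigma> * \<tau>"
        using tau s True c1 by (intro aus_modulus_dual_of_auc[OF refl]) (auto simp: mult_left_le_one_le)
      moreover have "\<sigma> * \<tau> = c1 powr (1 - p) * \<sigma> powr p"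
        using powr_add[of \<sigma> "p - 1" 1] s c1
        by (simp add: \<tau>_def powr_divide powr_diff field_simps)
      moreover have "\<sigma> * \<tau> / \<tau> = \<sigma>"
        using tau by simp
      ultimately show ?thesis
        by (simp only:)
    next
      case False
      \<comment> \<open>Away from 0 the trivial linear bound is already of order
        \<open>\<sigma> powr p\<close>, since \<open>1 - p\<close> is negative.\<close>
      have "aus_modulus (UNIV :: ('a \<Rightarrow>\<^sub>L real) set) \<sigma> \<le> \<sigma>"
        using s by (intro aus_modulus_le_self) auto
      also have "\<sigma> = \<sigma> powr (1 - p) * \<sigma> powr p"
        using s by (simp flip: powr_add)
      also have "\<dots> \<le> c1 powr (1 - p) * \<sigma> powr p"
        using False c1 p by (intro mult_right_mono powr_mono2') auto
      finally show ?thesis .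
    qed
    then show ?thesis
      using s by (simp add: divide_le_eq)
  qed
  then show ?thesis
    unfolding p_AUS_def by blast
qed

section \<open>Smoothness of the space of compact operators\<close>

text \<open>\<open>AUS\<close> and \<open>AUF\<close> are two-sided conditions, so the upper
  estimate has to be complemented by this lower bound.\<close>

lemma aus_modulus_compact_ops_nonneg:
  assumes "\<exists>f::'a::real_normed_vector \<Rightarrow>\<^sub>L real. f \<noteq> 0" "\<exists>y::'b::real_normed_vector. y \<noteq> 0" "0 \<le> \<sigma>"
  shows "0 \<le> aus_modulus (compact_ops :: ('a \<Rightarrow>\<^sub>L 'b) set) \<sigma>"
proof -
  obtain f :: "'a \<Rightarrow>\<^sub>L real" and y :: 'b where "f \<noteq> 0" "y \<noteq> 0"
    using assms(1,2) by blast
  then obtain T :: "'a \<Rightarrow>\<^sub>L 'b" where "T \<in> compact_ops" "norm T = 1"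
    by (rule compact_ops_norm_1)
  then show ?thesis
    by (rule aus_modulus_nonneg[OF compact_ops_0 _ _ assms(3)])
qed

lemma AUS_compact_ops:
  assumes X: "AUS (UNIV :: ('a::real_normed_vector \<Rightarrow>\<^sub>L real) set)"
    and Y: "AUS (UNIV :: 'b::real_normed_vector set)"
  shows "AUS (compact_ops :: ('a \<Rightarrow>\<^sub>L 'b) set)"
  unfolding AUS_def
proof (rule tendsto_sandwich)
  let ?X = "aus_modulus (UNIV :: ('a \<Rightarrow>\<^sub>L real) set)" and ?Y = "aus_modulus (UNIV :: 'b set)"
  let ?K = "aus_modulus (compact_ops :: ('a \<Rightarrow>\<^sub>L 'b) set)"
  have pos: "\<forall>\<^sub>F \<sigma> in at_right 0. 0 < (\<sigma>::real)"
    by (simp add: eventually_at_right_less)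
  show "\<forall>\<^sub>F \<sigma> in at_right 0. 0 \<le> ?K \<sigma> / \<sigma>"
    using pos
  proof eventually_elim
    case (elim \<sigma>)
    then show ?case
      using aus_modulus_compact_ops_nonneg[OF AUS_nontrivial[OF X] AUS_nontrivial[OF Y], of \<sigma>]
      by simp
  qed
  show "\<forall>\<^sub>F \<sigma> in at_right 0. ?K \<sigma> / \<sigma> \<le> 4 * max (?X (4 * \<sigma>) / (4 * \<sigma>)) (?Y (4 * \<sigma>) / (4 * \<sigma>))"
    using pos
  proof eventually_elim
    case (elim \<sigma>)
    then have "?K \<sigma> / \<sigma> \<le> max (?X (4 * \<sigma>)) (?Y (4 * \<sigma>)) / \<sigma>"
      using aus_modulus_compact_ops[OF elim] by (intro divide_right_mono) auto
    also have "\<dots> = 4 * max (?X (4 * \<sigma>) / (4 * \<sigma>)) (?Y (4 * \<sigma>) / (4 * \<sigma>))"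
      using elim by (auto simp: max_def field_simps)
    finally show ?case .
  qed
  have four: "filterlim (\<lambda>\<sigma>::real. 4 * \<sigma>) (at_right 0) (at_right 0)"
    unfolding filterlim_at using pos by (auto intro!: tendsto_eq_intros elim!: eventually_mono)
  show "((\<lambda>\<sigma>. 4 * max (?X (4 * \<sigma>) / (4 * \<sigma>)) (?Y (4 * \<sigma>) / (4 * \<sigma>))) \<longlongrightarrow> 0) (at_right 0)"
    using tendsto_mult_right_zero[OF tendsto_max[OF filterlim_compose[OF X[unfolded AUS_def] four]
        filterlim_compose[OF Y[unfolded AUS_def] four], simplified]]
    by simp
qed simp

lemma p_AUS_compact_ops:
  assumes X: "p_AUS p (UNIV :: ('a::real_normed_vector \<Rightarrow>\<^sub>L real) set)"
    and Y: "p_AUS p (UNIV :: 'b::real_normed_vector set)"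
  shows "p_AUS p (compact_ops :: ('a \<Rightarrow>\<^sub>L 'b) set)"
proof -
  let ?X = "aus_modulus (UNIV :: ('a \<Rightarrow>\<^sub>L real) set)" and ?Y = "aus_modulus (UNIV :: 'b set)"
  let ?K = "aus_modulus (compact_ops :: ('a \<Rightarrow>\<^sub>L 'b) set)"
  obtain C1 C2 where C: "\<And>\<sigma>. \<sigma> > 0 \<Longrightarrow> ?X \<sigma> / \<sigma> powr p \<le> C1" "\<And>\<sigma>. \<sigma> > 0 \<Longrightarrow> ?Y \<sigma> / \<sigma> powr p \<le> C2"
    using X Y unfolding p_AUS_def by blast
  have "?K \<sigma> / \<sigma> powr p \<le> max C1 C2 * 4 powr p" if s: "\<sigma> > 0" for \<sigma>
  proof -
    have "?X (4 * \<sigma>) \<le> max C1 C2 * (4 * \<sigma>) powr p" "?Y (4 * \<sigma>) \<le> max C1 C2 * (4 * \<sigma>) powr p"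
      using order_trans[OF C(1)[of "4 * \<sigma>"] max.cobounded1[of C1 C2]]
        order_trans[OF C(2)[of "4 * \<sigma>"] max.cobounded2[of C2 C1]] s
      by (simp_all add: divide_le_eq)
    then have "?K \<sigma> \<le> max C1 C2 * (4 * \<sigma>) powr p"
      using aus_modulus_compact_ops[OF s, where 'a = 'a and 'b = 'b] by linarith
    then show ?thesis
      using s by (simp add: divide_le_eq powr_mult mult.assoc)
  qed
  then show ?thesis
    unfolding p_AUS_def by blast
qed

lemma AUF_compact_ops:
  assumes X: "AUF (UNIV :: ('a::real_normed_vector \<Rightarrow>\<^sub>L real) set)"
    and Y: "AUF (UNIV :: 'b::real_normed_vector set)"
  shows "AUF (compact_ops :: ('a \<Rightarrow>\<^sub>L 'b) set)"
proof -
  let ?X = "aus_modulus (UNIV :: ('a \<Rightarrow>\<^sub>L real) set)" and ?Y = "aus_modulus (UNIV :: 'b set)"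
  obtain s1 s2 where s: "s1 > 0" "?X s1 = 0" "s2 > 0" "?Y s2 = 0"
    using X Y unfolding AUF_def by blast
  \<comment> \<open>Then \<open>4 * \<sigma>\<close> is below both flat radii, and monotonicity
    makes both moduli at \<open>4 * \<sigma>\<close> nonpositive.\<close>
  define \<sigma> where "\<sigma> = min s1 s2 / 4"
  have sig: "\<sigma> > 0" "4 * \<sigma> \<le> s1" "4 * \<sigma> \<le> s2"
    using s by (auto simp: \<sigma>_def)
  have "?X (4 * \<sigma>) \<le> 0" "?Y (4 * \<sigma>) \<le> 0"
    using aus_modulus_mono[of "UNIV :: ('a \<Rightarrow>\<^sub>L real) set" "4 * \<sigma>" s1]
      aus_modulus_mono[of "UNIV :: 'b set" "4 * \<sigma>" s2] s sig by auto
  then have "aus_modulus (compact_ops :: ('a \<Rightarrow>\<^sub>L 'b) set) \<sigma> \<le> 0"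
    using aus_modulus_compact_ops[OF sig(1), where 'a = 'a and 'b = 'b] by linarith
  moreover have "0 \<le> aus_modulus (compact_ops :: ('a \<Rightarrow>\<^sub>L 'b) set) \<sigma>"
    using aus_modulus_compact_ops_nonneg[OF AUF_nontrivial[OF X] AUF_nontrivial[OF Y]] sig by simp
  ultimately show ?thesis
    using sig(1) unfolding AUF_def by (intro exI[of _ \<sigma>]) auto
qed

theorem theorem1p4:
  fixes p :: real
  assumes AP: "has_AP TYPE('a::banach \<Rightarrow>\<^sub>L real) \<or> has_AP TYPE('b::banach)"
    and p: "1 < p"
  shows "(AUS (UNIV :: ('a \<Rightarrow>\<^sub>L real) set) \<and> AUS (UNIV :: 'b set)
            \<longrightarrow> AUS (compact_ops :: ('a \<Rightarrow>\<^sub>L 'b) set))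
       \<and> (p_AUS p (UNIV :: ('a \<Rightarrow>\<^sub>L real) set) \<and> p_AUS p (UNIV :: 'b set)
            \<longrightarrow> p_AUS p (compact_ops :: ('a \<Rightarrow>\<^sub>L 'b) set))
       \<and> (AUF (UNIV :: ('a \<Rightarrow>\<^sub>L real) set) \<and> AUF (UNIV :: 'b set)
            \<longrightarrow> AUF (compact_ops :: ('a \<Rightarrow>\<^sub>L 'b) set))
       \<and> (\<forall>q::real. 1 / p + 1 / q = 1 \<and> reflexive_space TYPE('a) \<and> q_AUC q TYPE('a)
            \<and> p_AUS p (UNIV :: 'b set)
            \<longrightarrow> p_AUS p (compact_ops :: ('a \<Rightarrow>\<^sub>L 'b) set))"
  using AUS_compact_ops p_AUS_compact_ops AUF_compact_ops p_AUS_dual_of_q_AUC[OF _ _ p] by blast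

end
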